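(* Let $K$ be a field, let $k\ge 2$ be an integer, and let $a,d\in\mathbb{N}^2$ be linearly independent over $\mathbb{Q}$ such that $\{a,a+d,\ldots,a+kd\}$ is a minimal generating set of $S_{a,d,k}=\langle a,a+d,\ldots,a+kd\rangle$. Then $$\mathrm{QF}(S_{a,d,k})=\{-(a+d),-(a+2d),\ldots,-(a+(k-1)d)\}.$$ In particular, the Cohen-Macaulay type of $K[S_{a,d,k}]$ is $k-1$.
   Context: $\mathbb{N}$ denotes the set of non-negative integers. $\langle a_1,\ldots,a_n\rangle=\{\sum_i\lambda_i a_i\mid \lambda_i\in\mathbb{N}\}$ is the affine semigroup generated by $a_1,\ldots,a_n\in\mathbb{N}^r$. For an affine semigroup $S\subseteq\mathbb{N}^r$, $K[S]=\bigoplus_{s\in S}K\mathbf{t}^s\subseteq K[t_1,\ldots,t_r]$ is its semigroup ring; the Cohen-Macaulay type of a Cohen-Macaulay $K[S]$ is the type at its unique monomial maximal ideal $\langle \mathbf{t}^s\mid s\in S\setminus\{0\}\rangle$. For a finite subset $E$ of nonzero elements of $S$, the Apery set is $\mathrm{Ap}(S,E)=\{b\in S\mid b-e\notin S \text{ for all } e\in E\}$. On $\mathbb{N}^r$ put $x\preceq_S y$ iff $y-x\in S$. A simplicial affine semigroup $S\subseteq\mathbb{N}^r$ is one having $r$ generators $a_1,\ldots,a_r$ (its extremal rays), linearly independent over $\mathbb{Q}$, such that every element of $S$ has a positive integer multiple in $\langle a_1,\ldots,a_r\rangle$. With $E=\{a_1,\ldots,a_r\}$, the set of quasi-Frobenius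 elements is $\mathrm{QF}(S)=\{b-\sum_{i=1}^r a_i\mid b\in\max_{\preceq_S}\mathrm{Ap}(S,E)\}$, where $\max_{\preceq_S}$ denotes the set of maximal elements. $S_{a,d,k}$ is simplicial in $\mathbb{N}^2$ with extremal rays $a$ and $a+kd$, so $E=\{a,a+kd\}$ here. *)

theory Defs
  imports
    "HOL-Analysis.Finite_Cartesian_Product"
    "HOL-Library.Poly_Mapping"
    "HOL-Library.Extended_Nat"
    "HOL-Algebra.Ring_Divisibility"
begin

section \<open>Affine semigroups\<close>

definition lin_indep_rat :: "nat ^ 'n \<Rightarrow> nat ^ 'n \<Rightarrow> bool" where
  "lin_indep_rat u v \<longleftrightarrow>
     (\<forall>p q :: rat. (\<forall>i. p * of_nat (u $ i) + q * of_nat (v $ i) = 0) \<longrightarrow> p = 0 \<and> q = 0)"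

definition affine_semigroup :: "(nat ^ 'n) set \<Rightarrow> (nat ^ 'n) set" where
  "affine_semigroup A = {\<Sum>x\<in>A. l x *s x | l. True}"

definition minimal_generating_set :: "(nat ^ 'n) set \<Rightarrow> (nat ^ 'n) set \<Rightarrow> bool" where
  "minimal_generating_set A S \<longleftrightarrow>
     affine_semigroup A = S \<and> (\<forall>B. B \<subset> A \<longrightarrow> affine_semigroup B \<noteq> S)"

definition arith_gens :: "nat ^ 'n \<Rightarrow> nat ^ 'n \<Rightarrow> nat \<Rightarrow> (nat ^ 'n) set" where
  "arith_gens a d k = (\<lambda>i. a + i *s d) ` {0..k}"

text \<open>Differences are taken in the group of integer vectors, because subtraction of natural
  numbers truncates.\<close>

definition int_vec :: "nat ^ 'n \<Rightarrow> int ^ 'n" where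
  "int_vec x = (\<chi> i. int (x $ i))"

definition semigroup_le :: "(nat ^ 'n) set \<Rightarrow> nat ^ 'n \<Rightarrow> nat ^ 'n \<Rightarrow> bool" where
  "semigroup_le S x y \<longleftrightarrow> int_vec y - int_vec x \<in> int_vec ` S"

definition apery_set :: "(nat ^ 'n) set \<Rightarrow> (nat ^ 'n) set \<Rightarrow> (nat ^ 'n) set" where
  "apery_set S E = {b \<in> S. \<forall>e\<in>E. int_vec b - int_vec e \<notin> int_vec ` S}"

definition maximal_elements :: "(nat ^ 'n) set \<Rightarrow> (nat ^ 'n) set \<Rightarrow> (nat ^ 'n) set" where
  "maximal_elements S X = {b \<in> X. \<forall>c\<in>X. semigroup_le S b c \<longrightarrow> c = b}"

text \<open>The quasi-Frobenius elements of a simplicial affine semigroup \<open>S\<close> whose set of extremal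
  rays is \<open>E\<close>.\<close>

definition quasi_frobenius :: "(nat ^ 'n) set \<Rightarrow> (nat ^ 'n) set \<Rightarrow> (int ^ 'n) set" where
  "quasi_frobenius S E =
     (\<lambda>b. int_vec b - (\<Sum>e\<in>E. int_vec e)) ` maximal_elements S (apery_set S E)"

section \<open>Semigroup rings\<close>

text \<open>The type \<open>(nat ^ 'n) \<Rightarrow>\<^sub>0 'k\<close> is the polynomial ring over \<open>'k\<close> with variables indexed
  by \<open>'n\<close>; the semigroup ring is the subring of the polynomials with exponents in \<open>S\<close>.\<close>

definition semigroup_ring :: "(nat ^ 'n) set \<Rightarrow> ((nat ^ 'n) \<Rightarrow>\<^sub>0 'k::field) ring" where
  "semigroup_ring S =
     \<lparr>carrier = {p. Poly_Mapping.keys p \<subseteq> S}, mult = (*), one = 1, zero = 0, add = (+)\<rparr>"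

definition monomial_maximal_ideal :: "(nat ^ 'n) set \<Rightarrow> ((nat ^ 'n) \<Rightarrow>\<^sub>0 'k::field) set" where
  "monomial_maximal_ideal S =
     genideal (semigroup_ring S) ((\<lambda>s. Poly_Mapping.single s 1) ` (S - {0}))"

section \<open>Localization at a prime ideal\<close>

text \<open>The fraction \<open>r / s\<close> is the class of the pair \<open>(r, s)\<close>.\<close>

definition fraction_rel :: "('a, 'b) ring_scheme \<Rightarrow> 'a set \<Rightarrow> (('a \<times> 'a) \<times> ('a \<times> 'a)) set" where
  "fraction_rel R P =
     {((r, s), (r', s')). r \<in> carrier R \<and> r' \<in> carrier R
        \<and> s \<in> carrier R - P \<and> s' \<in> carrier R - P
        \<and> (\<exists>t \<in> carrier R - P. t \<otimes>\<^bsub>R\<^esub> ((r \<otimes>\<^bsub>R\<^esub> s') \<ominus>\<^bsub>R\<^esub> (r' \<otimes>\<^bsub>R\<^esub> s)) = \<zero>\<^bsub>R\<^esub>)}"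

definition fraction :: "('a, 'b) ring_scheme \<Rightarrow> 'a set \<Rightarrow> 'a \<Rightarrow> 'a \<Rightarrow> ('a \<times> 'a) set" where
  "fraction R P r s = fraction_rel R P `` {(r, s)}"

definition localization :: "('a, 'b) ring_scheme \<Rightarrow> 'a set \<Rightarrow> ('a \<times> 'a) set ring" where
  "localization R P =
     \<lparr>carrier = (carrier R \<times> (carrier R - P)) // fraction_rel R P,
      mult = (\<lambda>X Y. \<Union>(r, s)\<in>X. \<Union>(r', s')\<in>Y. fraction R P (r \<otimes>\<^bsub>R\<^esub> r') (s \<otimes>\<^bsub>R\<^esub> s')),
      one = fraction R P \<one>\<^bsub>R\<^esub> \<one>\<^bsub>R\<^esub>,
      zero = fraction R P \<zero>\<^bsub>R\<^esub> \<one>\<^bsub>R\<^esub>,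
      add = (\<lambda>X Y. \<Union>(r, s)\<in>X. \<Union>(r', s')\<in>Y.
               fraction R P ((r \<otimes>\<^bsub>R\<^esub> s') \<oplus>\<^bsub>R\<^esub> (r' \<otimes>\<^bsub>R\<^esub> s)) (s \<otimes>\<^bsub>R\<^esub> s'))\<rparr>"

section \<open>Cohen-Macaulay local rings and their type\<close>

definition noetherian_local_ring :: "('a, 'b) ring_scheme \<Rightarrow> bool" where
  "noetherian_local_ring A \<longleftrightarrow> cring A \<and> noetherian_ring A \<and> (\<exists>!M. maximalideal M A)"

definition the_max_ideal :: "('a, 'b) ring_scheme \<Rightarrow> 'a set" where
  "the_max_ideal A = (THE M. maximalideal M A)"

definition krull_dim :: "('a, 'b) ring_scheme \<Rightarrow> enat" where
  "krull_dim A =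
     Sup {enat n | n. \<exists>P. (\<forall>i\<le>n. primeideal (P i) A) \<and> (\<forall>i<n. P i \<subset> P (Suc i))}"

text \<open>The element \<open>xs ! i\<close> is a nonzerodivisor modulo the ideal generated by its predecessors.\<close>

definition regular_sequence :: "('a, 'b) ring_scheme \<Rightarrow> 'a list \<Rightarrow> bool" where
  "regular_sequence A xs \<longleftrightarrow>
     set xs \<subseteq> carrier A \<and> genideal A (set xs) \<noteq> carrier A \<and>
     (\<forall>i<length xs. \<forall>y\<in>carrier A.
        xs ! i \<otimes>\<^bsub>A\<^esub> y \<in> genideal A (set (take i xs)) \<longrightarrow> y \<in> genideal A (set (take i xs)))"

definition depth :: "('a, 'b) ring_scheme \<Rightarrow> enat" where
  "depth A = Sup {enat (length xs) | xs. set xs \<subseteq> the_max_ideal A \<and> regular_sequence A xs}"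

definition cohen_macaulay_local :: "('a, 'b) ring_scheme \<Rightarrow> bool" where
  "cohen_macaulay_local A \<longleftrightarrow> noetherian_local_ring A \<and> depth A = krull_dim A"

text \<open>The socle of the module \<open>A / I\<close> over the local ring \<open>A\<close>: the elements killed by the maximal
  ideal of \<open>A\<close>.\<close>

definition socle_Quot :: "('a, 'b) ring_scheme \<Rightarrow> 'a set \<Rightarrow> 'a set set" where
  "socle_Quot A I =
     {z \<in> carrier (A Quot I). \<forall>r\<in>the_max_ideal A. (I +>\<^bsub>A\<^esub> r) \<otimes>\<^bsub>A Quot I\<^esub> z = \<zero>\<^bsub>A Quot I\<^esub>}"

text \<open>As the maximal ideal \<open>M\<close> of \<open>A\<close> kills the socle, the socle is a vector space over \<open>A / M\<close>.
  The scalars are represented by elements of \<open>A\<close>, and a scalar is zero iff its representative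
  lies in \<open>M\<close>.\<close>

definition socle_basis :: "('a, 'b) ring_scheme \<Rightarrow> 'a set \<Rightarrow> nat \<Rightarrow> (nat \<Rightarrow> 'a set) \<Rightarrow> bool" where
  "socle_basis A I n v \<longleftrightarrow>
     v \<in> {..<n} \<rightarrow> socle_Quot A I \<and>
     (\<forall>z\<in>socle_Quot A I. \<exists>c \<in> {..<n} \<rightarrow> carrier A.
        z = (\<Oplus>\<^bsub>A Quot I\<^esub> i\<in>{..<n}. (I +>\<^bsub>A\<^esub> c i) \<otimes>\<^bsub>A Quot I\<^esub> v i)) \<and>
     (\<forall>c \<in> {..<n} \<rightarrow> carrier A.
        (\<Oplus>\<^bsub>A Quot I\<^esub> i\<in>{..<n}. (I +>\<^bsub>A\<^esub> c i) \<otimes>\<^bsub>A Quot I\<^esub> v i) = \<zero>\<^bsub>A Quot I\<^esub>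
          \<longrightarrow> (\<forall>i<n. c i \<in> the_max_ideal A))"

text \<open>The type of a Cohen-Macaulay local ring \<open>A\<close> of dimension \<open>t\<close> is the dimension over the
  residue field of the socle of \<open>A / (x\<^sub>1, \<dots>, x\<^sub>t)\<close>, for any regular sequence
  \<open>x\<^sub>1, \<dots>, x\<^sub>t\<close> in the maximal ideal; it does not depend on the sequence. The
  quantification over all sequences is not vacuous, because a Cohen-Macaulay ring has one.\<close>

definition has_cohen_macaulay_type :: "('a, 'b) ring_scheme \<Rightarrow> nat \<Rightarrow> bool" where
  "has_cohen_macaulay_type A n \<longleftrightarrow>
     cohen_macaulay_local A \<and>
     (\<forall>xs. set xs \<subseteq> the_max_ideal A \<and> regular_sequence A xs \<and> enat (length xs) = krull_dim A
        \<longrightarrow> (\<exists>v. socle_basis A (genideal A (set xs)) n v))"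

end

theory Submission
  imports Defs "HOL-Computational_Algebra.Polynomial_Factorial"
begin

text \<open>The semigroup is \<open>S = {m a + j d | 0 \<le> j \<le> k m}\<close>, and independence of \<open>a\<close> and \<open>d\<close> makes the
pair \<open>(m, j)\<close> unique. Subtracting \<open>a\<close> from \<open>m a + j d\<close> leaves \<open>S\<close> unless \<open>m \<ge> 1\<close> and
\<open>j \<le> k (m - 1)\<close>; subtracting \<open>a + k d\<close> leaves \<open>S\<close> unless \<open>j \<ge> k\<close>. Both fail exactly for \<open>0\<close> and
for the \<open>a + j d\<close> with \<open>0 < j < k\<close>. The latter all have \<open>m = 1\<close>, so none lies below another, and each
lies above \<open>0\<close>: they are the maximal elements of the Apery set, and subtracting \<open>2 a + k d\<close> turns
\<open>a + j d\<close> into \<open>- (a + (k - j) d)\<close>.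

For the type, \<open>t^(m a + j d) \<mapsto> X^m Y^j\<close> identifies \<open>K[S]\<close> with the ring \<open>V\<close> of the polynomials in
\<open>X\<close> whose \<open>m\<close>-th coefficient is a polynomial in \<open>Y\<close> of degree at most \<open>k m\<close>, the coordinate ring of
the cone over the rational normal curve of degree \<open>k\<close>. Its localization at the vertex becomes a
subring \<open>L\<close> of the field of fractions \<open>K(X, Y)\<close>, with maximal ideal \<open>M\<close>, so that all calculations take
place in a field. Let \<open>u = X\<close> and \<open>v = X Y^k\<close>, the images of the two extremal rays.

The ring is Noetherian by the Groebner basis argument: the leading exponents \<open>(m, j)\<close> of an ideal
are finitely generated by Dickson's lemma applied to \<open>(j, k m - j)\<close>, as divisibility of monomials in
\<open>V\<close> is the product order on these pairs (\<open>V_noetherian\<close>, \<open>L_noetherian\<close>).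

The dimension is two. The multiples of \<open>Y\<close> form a prime \<open>P_v\<close>, and \<open>0 \<subset> P_v \<subset> M\<close>. A chain
\<open>P0 \<subset> P1 \<subset> P2 \<subset> P3\<close> is impossible: choose an element of each difference; these three polynomials in
two variables are algebraically dependent, and running up the chain shows that the
lexicographically lowest coefficient of a relation, a nonzero constant, lies in \<open>P3\<close>
(\<open>L_no_long_prime_chain\<close>).

The socle dimension does not depend on the regular sequence. If \<open>y\<close> and \<open>z\<close> are both regular modulo
\<open>x\<close>, then \<open>w \<mapsto> z w / y\<close> maps the socle of \<open>L / (x, y)\<close> isomorphically onto that of \<open>L / (x, z)\<close>
(\<open>socle_basis_exchange\<close>), and in a domain regular pairs can be swapped (\<open>regular_mod_swap\<close>). An element
outside \<open>P_v\<close> is regular modulo \<open>v\<close>, whereas the \<open>k\<close>-th power of an element of \<open>P_v\<close> is a multiple of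
\<open>v\<close>, so that a regular pair cannot lie in \<open>P_v\<close>. If \<open>y \<notin> P_v\<close>, the steps \<open>(x, y) \<rightarrow> (v, y) \<rightarrow> (v, u)\<close>
reduce to the pair \<open>(v, u)\<close> (\<open>socle_basis_exists\<close>). The ideal \<open>(v, u)\<close> contains everything of degree at
least two in \<open>X\<close>, and the socle of the quotient is spanned by the \<open>k - 1\<close> monomials \<open>X Y^j\<close> with
\<open>0 < j < k\<close> (\<open>socle_basis_params\<close>). Since it is nonzero, no regular sequence is longer than two, so
depth and dimension agree.\<close>

section \<open>Socles over subrings of a domain\<close>

text \<open>Rings and ideals are sets inside an ambient domain, so that identities between their elements are
identities of the ambient type class; \<open>ring_model\<close> below carries the results to record rings.\<close>

locale domain_subring =
  fixes B :: "'f::idom set"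
  assumes zero_closed: "0 \<in> B"
    and one_closed: "1 \<in> B"
    and add_closed: "x \<in> B \<Longrightarrow> y \<in> B \<Longrightarrow> x + y \<in> B"
    and mult_closed: "x \<in> B \<Longrightarrow> y \<in> B \<Longrightarrow> x * y \<in> B"
    and uminus_closed: "x \<in> B \<Longrightarrow> - x \<in> B"
begin

lemma diff_closed: "x \<in> B \<Longrightarrow> y \<in> B \<Longrightarrow> x - y \<in> B"
  using add_closed[OF _ uminus_closed, of x y] by simp

lemma sum_closed: "(\<And>i. i \<in> I \<Longrightarrow> f i \<in> B) \<Longrightarrow> sum f I \<in> B"
  by (induction I rule: infinite_finite_induct) (auto intro: zero_closed add_closed)

lemma power_closed: "x \<in> B \<Longrightarrow> x ^ n \<in> B"
  by (induction n) (auto intro: one_closed mult_closed)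

lemmas closed = zero_closed one_closed add_closed mult_closed uminus_closed diff_closed
  sum_closed power_closed

definition ideal_in :: "'f set \<Rightarrow> bool" where
  "ideal_in I \<longleftrightarrow> I \<subseteq> B \<and> 0 \<in> I \<and> (\<forall>x\<in>I. \<forall>y\<in>I. x + y \<in> I) \<and> (\<forall>r\<in>B. \<forall>x\<in>I. r * x \<in> I)"

lemma ideal_in_uminus: "ideal_in I \<Longrightarrow> x \<in> I \<Longrightarrow> - x \<in> I"
  unfolding ideal_in_def using uminus_closed[OF one_closed] by (metis mult_minus1)

lemma ideal_in_diff: "ideal_in I \<Longrightarrow> x \<in> I \<Longrightarrow> y \<in> I \<Longrightarrow> x - y \<in> I"
  using ideal_in_uminus[of I y] unfolding ideal_in_def by (metis diff_conv_add_uminus)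

lemma ideal_in_sum: "ideal_in I \<Longrightarrow> (\<And>i. i \<in> A \<Longrightarrow> f i \<in> I) \<Longrightarrow> sum f A \<in> I"
  by (induction A rule: infinite_finite_induct) (auto simp: ideal_in_def)

definition prime_in :: "'f set \<Rightarrow> bool" where
  "prime_in P \<longleftrightarrow> ideal_in P \<and> P \<noteq> B \<and> (\<forall>x\<in>B. \<forall>y\<in>B. x * y \<in> P \<longrightarrow> x \<in> P \<or> y \<in> P)"

definition ideal2 :: "'f \<Rightarrow> 'f \<Rightarrow> 'f set" where
  "ideal2 x y = {x * p + y * q | p q. p \<in> B \<and> q \<in> B}"

lemma ideal2_commute: "ideal2 x y = ideal2 y x"
proof -
  have "ideal2 x y \<subseteq> ideal2 y x" for x y
  proof
    fix z assume "z \<in> ideal2 x y"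
    then obtain p q where "p \<in> B" "q \<in> B" "z = x * p + y * q"
      unfolding ideal2_def by blast
    then have "q \<in> B \<and> p \<in> B \<and> z = y * q + x * p"
      by simp
    then show "z \<in> ideal2 y x"
      unfolding ideal2_def by blast
  qed
  then show ?thesis
    by blast
qed

lemma ideal2I: "p \<in> B \<Longrightarrow> q \<in> B \<Longrightarrow> z = x * p + y * q \<Longrightarrow> z \<in> ideal2 x y"
  unfolding ideal2_def by blast

lemma ideal2E:
  assumes "z \<in> ideal2 x y"
  obtains p q where "p \<in> B" "q \<in> B" "z = x * p + y * q"
  using assms unfolding ideal2_def by blast

lemma ideal_in_ideal2: 
  assumes "x \<in> B" "y \<in> B"
  shows "ideal_in (ideal2 x y)"
  unfolding ideal_in_def
proof (intro conjI ballI)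
  show "ideal2 x y \<subseteq> B"
    using assms by (auto elim!: ideal2E intro!: closed)
  show "0 \<in> ideal2 x y"
    by (rule ideal2I[of 0 0]) (auto intro: closed)
next
  fix z w assume "z \<in> ideal2 x y" "w \<in> ideal2 x y"
  then obtain p q p' q' where "p \<in> B" "q \<in> B" "z = x * p + y * q" "p' \<in> B" "q' \<in> B"
      "w = x * p' + y * q'"
    by (auto elim!: ideal2E)
  then show "z + w \<in> ideal2 x y"
    by (intro ideal2I[of "p + p'" "q + q'"]) (auto intro: closed simp: algebra_simps)
next
  fix r z assume "r \<in> B" "z \<in> ideal2 x y"
  then obtain p q where "p \<in> B" "q \<in> B" "z = x * p + y * q" "r \<in> B"
    by (auto elim!: ideal2E)
  then show "r * z \<in> ideal2 x y"
    by (intro ideal2I[of "r * p" "r * q"]) (auto intro: closed simp: algebra_simps)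
qed

text \<open>Multiplication by \<open>y\<close> is injective on \<open>B / (x)\<close>.\<close>

definition regular_mod :: "'f \<Rightarrow> 'f \<Rightarrow> bool" where
  "regular_mod x y \<longleftrightarrow> (\<forall>f\<in>B. \<forall>g\<in>B. y * f = x * g \<longrightarrow> (\<exists>h\<in>B. f = x * h))"

lemma regular_modD:
  "regular_mod x y \<Longrightarrow> f \<in> B \<Longrightarrow> g \<in> B \<Longrightarrow> y * f = x * g \<Longrightarrow> \<exists>h\<in>B. f = x * h"
  unfolding regular_mod_def by blast

text \<open>In \<open>x f = y g\<close>, regularity of \<open>y\<close> gives \<open>g = x h\<close>, and then \<open>x\<close> cancels because the ring is a domain.\<close>

lemma regular_mod_swap:
  assumes "regular_mod x y" "x \<noteq> 0"
  shows "regular_mod y x"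
  unfolding regular_mod_def
proof (intro ballI impI)
  fix f g assume fg: "f \<in> B" "g \<in> B" "x * f = y * g"
  then obtain h where "h \<in> B" "g = x * h"
    using regular_modD[OF assms(1), of g f] by metis
  then show "\<exists>h\<in>B. f = y * h"
    using fg(3) assms(2) by (intro bexI[of _ h]) (auto simp: algebra_simps)
qed

lemma regular_mod_power:
  assumes "regular_mod x y" "y \<in> B"
  shows "regular_mod x (y ^ n)"
  unfolding regular_mod_def
proof (intro ballI impI)
  fix f g assume "f \<in> B" "g \<in> B" "y ^ n * f = x * g"
  then show "\<exists>h\<in>B. f = x * h"
  proof (induction n arbitrary: f)
    case (Suc n)
    have "y ^ n * (y * f) = x * g"
      using Suc.prems(3) by (simp add: algebra_simps)
    then obtain h where "h \<in> B" "y * f = x * h"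
      using Suc.IH[of "y * f"] Suc.prems assms(2) closed by blast
    then show ?case
      using regular_modD[OF assms(1)] Suc.prems by blast
  qed auto
qed

text \<open>The powers \<open>x^n\<close> and \<open>y^n\<close> are again a regular pair, so their only common divisors are units. This
keeps a regular pair out of any ideal all of whose elements have a power in \<open>(u)\<close>.\<close>

lemma regular_pair_powers_not_common_multiple:
  assumes "regular_mod x y" "x \<in> B" "y \<in> B" "x \<noteq> 0" "y \<noteq> 0"
    and "f \<in> B" "g \<in> B" "x ^ n = u * f" "y ^ n = u * g"
  shows "\<exists>h\<in>B. u * h = 1"
proof -
  have "regular_mod (y ^ n) (x ^ n)"
    using regular_mod_power[OF regular_mod_swap[OF regular_mod_power[OF assms(1,3)] assms(4)] assms(2)] .
  moreover have "x ^ n * g = y ^ n * f"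
    using assms(8,9) by (simp add: algebra_simps)
  ultimately obtain h where h: "h \<in> B" "g = y ^ n * h"
    using regular_modD assms(6,7) by blast
  then have "y ^ n * (u * h) = y ^ n * 1"
    using assms(9) by (metis mult.assoc mult.commute mult.right_neutral)
  then show ?thesis
    using assms(5) h(1) by (metis mult_cancel_left power_not_zero)
qed

text \<open>The elements \<open>b i\<close> represent a basis of the socle of \<open>B / I\<close> over the residue field \<open>B / M\<close>; cosets
and scalars are replaced by representatives in \<open>B\<close>.\<close>

definition socle_basis_in :: "'f set \<Rightarrow> 'f set \<Rightarrow> nat \<Rightarrow> (nat \<Rightarrow> 'f) \<Rightarrow> bool" where
  "socle_basis_in M I n b \<longleftrightarrow>
     (\<forall>i<n. b i \<in> B \<and> (\<forall>r\<in>M. r * b i \<in> I)) \<and>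
     (\<forall>z\<in>B. (\<forall>r\<in>M. r * z \<in> I) \<longrightarrow> (\<exists>c. (\<forall>i<n. c i \<in> B) \<and> z - (\<Sum>i<n. c i * b i) \<in> I)) \<and>
     (\<forall>c. (\<forall>i<n. c i \<in> B) \<longrightarrow> (\<Sum>i<n. c i * b i) \<in> I \<longrightarrow> (\<forall>i<n. c i \<in> M))"

lemma socle_transfer:
  assumes "z \<in> M" "x \<in> B" "w \<in> B" "\<forall>r\<in>M. r * w \<in> ideal2 x y"
  obtains w' e where "w' \<in> B" "e \<in> B" "z * w = y * w' + x * e"
proof -
  from assms have "z * w \<in> ideal2 x y" by blast
  then show ?thesis using that by (metis ideal2E add.commute)
qed

text \<open>The element \<open>w'\<close> is \<open>z w / y\<close> computed modulo \<open>x\<close>. If \<open>r w = y q\<close> modulo \<open>x\<close>, then \<open>y r w' = z r w = y z q\<close>,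
and \<open>y\<close> cancels modulo \<open>x\<close>.\<close>

lemma socle_transfer_in_socle:
  assumes reg: "regular_mod x y" and B: "x \<in> B" "y \<in> B" "z \<in> B" and M: "M \<subseteq> B"
    and w: "w \<in> B" "\<forall>r\<in>M. r * w \<in> ideal2 x y"
    and w': "w' \<in> B" "e \<in> B" "z * w = y * w' + x * e"
  shows "\<forall>r\<in>M. r * w' \<in> ideal2 x z"
proof
  fix r assume "r \<in> M"
  then have r: "r \<in> B" using M by blast
  obtain p q where pq: "p \<in> B" "q \<in> B" "r * w = x * p + y * q"
    using w \<open>r \<in> M\<close> by (metis ideal2E)
  have "y * (r * w' - z * q) = r * (y * w' + x * e) - r * x * e - z * y * q"
    by (simp add: algebra_simps)
  also have "\<dots> = z * (r * w) - r * x * e - z * y * q"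
    unfolding w'(3)[symmetric] by (simp add: algebra_simps)
  also have "\<dots> = x * (z * p - r * e)"
    unfolding pq(3) by (simp add: algebra_simps)
  finally obtain h where h: "h \<in> B" "r * w' - z * q = x * h"
    using regular_modD[OF reg, of "r * w' - z * q" "z * p - r * e"] r w' pq B
    by (auto intro: closed)
  then show "r * w' \<in> ideal2 x z"
    by (intro ideal2I[of h q]) (auto intro: pq simp: algebra_simps)
qed

text \<open>The map \<open>w \<mapsto> z w / y\<close> from the socle modulo \<open>(x, y)\<close> to the socle modulo \<open>(x, z)\<close> is linear over
\<open>B\<close>, and \<open>w' \<mapsto> y w' / z\<close> is its inverse. So it sends a basis to a basis.\<close>

lemma socle_basis_exchange:
  assumes reg: "regular_mod x y" "regular_mod x z"
    and B: "x \<in> B" "y \<in> B" "z \<in> B" and M: "M \<subseteq> B" "y \<in> M" "z \<in> M"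
    and b: "socle_basis_in M (ideal2 x y) n b"
  shows "\<exists>b'. socle_basis_in M (ideal2 x z) n b'"
proof -
  have bB: "b i \<in> B" and bM: "\<forall>r\<in>M. r * b i \<in> ideal2 x y" if "i < n" for i
    using b that unfolding socle_basis_in_def by blast+
  have "\<forall>i. \<exists>w' e. i < n \<longrightarrow> w' \<in> B \<and> e \<in> B \<and> z * b i = y * w' + x * e"
    using socle_transfer[OF M(3) B(1) bB bM] by metis
  then obtain b' e where b': "\<And>i. i < n \<Longrightarrow> b' i \<in> B" "\<And>i. i < n \<Longrightarrow> e i \<in> B"
    "\<And>i. i < n \<Longrightarrow> z * b i = y * b' i + x * e i"
    by metis
  \<comment> \<open>Linearity of the transfer, with the multiples of \<open>x\<close> kept explicit.\<close>
  have comb: "z * (\<Sum>i<n. c i * b i) = y * (\<Sum>i<n. c i * b' i) + x * (\<Sum>i<n. c i * e i)" for c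
  proof -
    have "z * (\<Sum>i<n. c i * b i) = (\<Sum>i<n. c i * (z * b i))"
      by (simp add: sum_distrib_left algebra_simps)
    also have "\<dots> = (\<Sum>i<n. c i * (y * b' i + x * e i))"
      by (intro sum.cong) (auto simp: b')
    also have "\<dots> = y * (\<Sum>i<n. c i * b' i) + x * (\<Sum>i<n. c i * e i)"
      by (simp add: sum_distrib_left sum.distrib algebra_simps)
    finally show ?thesis .
  qed
  have "socle_basis_in M (ideal2 x z) n b'"
    unfolding socle_basis_in_def
  proof (intro conjI allI impI)
    fix i assume i: "i < n"
    show "b' i \<in> B" using b' i by blast
    show "\<forall>r\<in>M. r * b' i \<in> ideal2 x z"
      using socle_transfer_in_socle[OF reg(1) B M(1) bB bM b'] i by blast
  next
    show "\<forall>w'\<in>B. (\<forall>r\<in>M. r * w' \<in> ideal2 x z) \<longrightarrow>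
        (\<exists>c. (\<forall>i<n. c i \<in> B) \<and> w' - (\<Sum>i<n. c i * b' i) \<in> ideal2 x z)"
    proof (intro ballI impI)
      fix w' assume w': "w' \<in> B" "\<forall>r\<in>M. r * w' \<in> ideal2 x z"
      obtain w f where w: "w \<in> B" "f \<in> B" "y * w' = z * w + x * f"
        using socle_transfer[OF M(2) B(1) w'] .
      have "\<forall>r\<in>M. r * w \<in> ideal2 x y"
        using socle_transfer_in_socle[OF reg(2) B(1,3,2) M(1) w' w] .
      then obtain c where c: "\<forall>i<n. c i \<in> B" "w - (\<Sum>i<n. c i * b i) \<in> ideal2 x y"
        using b w(1) unfolding socle_basis_in_def by blast
      then obtain p q where pq: "p \<in> B" "q \<in> B" "w - (\<Sum>i<n. c i * b i) = x * p + y * q"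
        by (metis ideal2E)
      let ?s = "\<Sum>i<n. c i * b i" and ?s' = "\<Sum>i<n. c i * b' i" and ?e = "\<Sum>i<n. c i * e i"
      have eB: "?e \<in> B" and sB: "?s' \<in> B"
        using c(1) b' by (auto intro!: closed)
      have "y * (w' - ?s' - z * q) = (y * w' - z * w) + z * (w - ?s) - z * y * q
          + (z * ?s - y * ?s')"
        by (simp add: algebra_simps)
      also have "\<dots> = x * (f + z * p + ?e)"
        unfolding pq(3) w(3) comb by (simp add: algebra_simps)
      finally obtain h where "h \<in> B" "w' - ?s' - z * q = x * h"
        using regular_modD[OF reg(1), of "w' - ?s' - z * q" "f + z * p + ?e"] w w' pq B eB sB
        by (auto intro: closed)
      then have "w' - ?s' \<in> ideal2 x z"
        by (intro ideal2I[of h q]) (auto intro: pq simp: algebra_simps)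
      then show "\<exists>c. (\<forall>i<n. c i \<in> B) \<and> w' - (\<Sum>i<n. c i * b' i) \<in> ideal2 x z"
        using c(1) by blast
    qed
  next
    fix c j assume c: "\<forall>i<n. c i \<in> B" and in_I: "(\<Sum>i<n. c i * b' i) \<in> ideal2 x z" and j: "j < n"
    let ?s = "\<Sum>i<n. c i * b i" and ?e = "\<Sum>i<n. c i * e i"
    obtain p q where pq: "p \<in> B" "q \<in> B" "(\<Sum>i<n. c i * b' i) = x * p + z * q"
      using in_I by (metis ideal2E)
    have eB: "?e \<in> B" and sB: "?s \<in> B"
      using c b' bB by (auto intro!: closed)
    have "z * (?s - y * q) = x * (y * p + ?e)"
      using comb[of c] unfolding pq(3) by (simp add: algebra_simps)
    then obtain h where "h \<in> B" "?s - y * q = x * h"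
      using regular_modD[OF reg(2), of "?s - y * q" "y * p + ?e"] pq B eB sB
      by (auto intro: closed)
    then have "?s \<in> ideal2 x y"
      by (intro ideal2I[of h q]) (auto intro: pq simp: algebra_simps)
    then show "c j \<in> M"
      using b c j unfolding socle_basis_in_def by blast
  qed
  then show ?thesis by blast
qed

end

section \<open>Auxiliary facts on polynomials, fractions and exponents\<close>

lemma coeff_Suc_0_mult:
  "coeff (p * q) (Suc 0) = coeff p 0 * coeff q (Suc 0) + coeff p (Suc 0) * coeff q 0"
  for p q :: "'a::comm_semiring_0 poly"
  by (simp add: coeff_mult)

lemma fract_eq_iff:
  fixes p q p' q' :: "'a::idom"
  assumes "q \<noteq> 0" "q' \<noteq> 0"
  shows "to_fract p / to_fract q = to_fract p' / to_fract q' \<longleftrightarrow> p * q' = p' * q"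
  using assms by (simp add: frac_eq_eq flip: to_fract_mult)

lemma to_fract_sum: "to_fract (sum f A) = (\<Sum>i\<in>A. to_fract (f i))"
  by (induction A rule: infinite_finite_induct) auto

lemma to_fract_power: "to_fract (r ^ n) = to_fract r ^ n" for r :: "'a::idom"
  by (induction n) simp_all

lemma coeff_sum_constants:
  "coeff (\<Sum>i<n. [:c i:] * monom 1 (Suc i)) (Suc j) = (if j < n then c j else (0::'a::comm_semiring_1))"
  by (simp add: coeff_sum smult_monom if_distrib cong: if_cong)

section \<open>The cone over the rational normal curve and its local ring\<close>

locale cone_over_normal_curve =
  fixes k :: nat and field_type :: "'k::field itself"
  assumes two_le_k: "2 \<le> k"
begin

text \<open>The polynomials are in \<open>X\<close> with coefficients that are polynomials in \<open>Y\<close>: \<open>monom (monom c j) m\<close> is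
\<open>c X^m Y^j\<close>, and \<open>V\<close> is spanned by the monomials with \<open>j \<le> k m\<close>.\<close>

definition V :: "'k poly poly set" where
  "V = {p. \<forall>m. Polynomial.degree (coeff p m) \<le> k * m}"

definition u :: "'k poly poly" where "u = monom 1 1"
definition v :: "'k poly poly" where "v = monom (monom 1 k) 1"

lemma k_pos: "0 < k" using two_le_k by simp

lemma VD: "p \<in> V \<Longrightarrow> Polynomial.degree (coeff p m) \<le> k * m"
  by (simp add: V_def)

lemma V_mult:
  assumes "p \<in> V" "q \<in> V"
  shows "p * q \<in> V"
proof -
  have "Polynomial.degree (coeff (p * q) n) \<le> k * n" for n
    unfolding coeff_mult
  proof (rule degree_sum_le)
    fix i assume i: "i \<in> {..n}"
    have "Polynomial.degree (coeff p i * coeff q (n - i)) \<le> k * i + k * (n - i)"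
      using degree_mult_le[of "coeff p i" "coeff q (n - i)"] VD[OF assms(1), of i]
        VD[OF assms(2), of "n - i"] by linarith
    also have "\<dots> = k * n"
      using i by (simp flip: distrib_left)
    finally show "Polynomial.degree (coeff p i * coeff q (n - i)) \<le> k * n" .
  qed simp
  then show ?thesis by (simp add: V_def)
qed

lemma monom_in_V: "Polynomial.degree c \<le> k * m \<Longrightarrow> monom c m \<in> V"
  by (auto simp: V_def)

sublocale V: domain_subring V
proof
  fix x y assume "x \<in> V" "y \<in> V"
  then show "x + y \<in> V"
    by (auto simp: V_def intro: degree_add_le)
qed (use monom_in_V[of 1 0] V_mult in \<open>auto simp: V_def\<close>)

lemma u_in_V: "u \<in> V" and v_in_V: "v \<in> V"
  by (auto simp: u_def v_def degree_monom_le intro!: monom_in_V)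

lemma u_nonzero: "u \<noteq> 0" and v_nonzero: "v \<noteq> 0"
  by (auto simp: u_def v_def monom_eq_0_iff)

lemma constant_coeff_in_V:
  assumes "p \<in> V"
  obtains c where "coeff p 0 = [:c:]"
  using VD[OF assms, of 0] by (auto elim: degree_eq_zeroE)

text \<open>Membership in the ideal \<open>(v, u)\<close> of \<open>V\<close> is decided by the coefficients of \<open>X^0\<close> and \<open>X^1\<close>
(\<open>mem_params_ideal_iff\<close>).\<close>

definition linear_part_in_params :: "'k poly poly \<Rightarrow> bool" where
  "linear_part_in_params p \<longleftrightarrow> coeff p 0 = 0 \<and> (\<forall>j. 0 < j \<and> j < k \<longrightarrow> coeff (coeff p 1) j = 0)"

lemma linear_part_in_params_add:
  "linear_part_in_params p \<Longrightarrow> linear_part_in_params q \<Longrightarrow> linear_part_in_params (p + q)"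
  by (simp add: linear_part_in_params_def)

text \<open>The coefficient of \<open>X^0\<close> in \<open>q\<close> has degree \<open>0\<close> in \<open>Y\<close>, so it only scales the linear part of \<open>p\<close>.\<close>

lemma linear_part_in_params_mult:
  assumes "linear_part_in_params p" "q \<in> V"
  shows "linear_part_in_params (q * p)"
proof -
  obtain c where "coeff q 0 = [:c:]" using constant_coeff_in_V[OF assms(2)] .
  then show ?thesis
    using assms(1) by (auto simp: linear_part_in_params_def coeff_Suc_0_mult coeff_mult_0)
qed

lemma linear_part_in_params_u: "linear_part_in_params u"
  and linear_part_in_params_v: "linear_part_in_params v"
  by (auto simp: linear_part_in_params_def u_def v_def coeff_1)

text \<open>Dividing \<open>c\<close> by \<open>Y^k\<close> splits \<open>c X^(m+1)\<close> into a multiple of \<open>v = X Y^k\<close> and a multiple of \<open>u = X\<close>. The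
remainder has degree below \<open>k\<close>, which is at most \<open>k m\<close> unless \<open>m = 0\<close>; the second hypothesis covers
that case.\<close>

lemma monom_in_params_ideal:
  assumes "Polynomial.degree c \<le> k * Suc m"
    and "m = 0 \<Longrightarrow> \<forall>j. 0 < j \<and> j < k \<longrightarrow> coeff c j = 0"
  shows "monom c (Suc m) \<in> V.ideal2 v u"
proof -
  define c1 where "c1 = c mod monom 1 k"
  define c2 where "c2 = c div monom 1 k"
  have deg_k: "Polynomial.degree (monom 1 k :: 'k poly) = k"
    by (simp add: degree_monom_eq)
  have "c1 = 0 \<or> Polynomial.degree c1 < k"
    unfolding c1_def using degree_mod_less[of "monom 1 k" c] deg_k by (auto simp: monom_eq_0_iff)
  then have c1_less: "Polynomial.degree c1 < k" using k_pos by auto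
  have c: "c = monom 1 k * c2 + c1" by (simp add: c1_def c2_def)
  have c2_deg: "Polynomial.degree c2 \<le> k * m"
  proof (cases "c2 = 0")
    case False
    have "Polynomial.degree (monom 1 k * c2) = k + Polynomial.degree c2"
      using False by (subst degree_mult_eq) (auto simp: monom_eq_0_iff deg_k)
    moreover have "Polynomial.degree (monom 1 k * c2 + c1) = Polynomial.degree (monom 1 k * c2)"
      using calculation c1_less by (intro degree_add_eq_left) auto
    ultimately show ?thesis using assms(1) c by simp
  qed simp
  have c1_deg: "Polynomial.degree c1 \<le> k * m"
  proof (cases "m = 0")
    case True
    have "coeff c1 j = 0" if "j > 0" for j
    proof (cases "j < k")
      case True
      then have "coeff c1 j = coeff c j"
        using c by (simp add: coeff_monom_mult)
      then show ?thesis using assms(2) \<open>m = 0\<close> that True by auto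
    next
      case False
      then show ?thesis using c1_less by (intro coeff_eq_0) simp
    qed
    then show ?thesis using True by (intro degree_le) auto
  next
    case False
    then show ?thesis using c1_less by (cases m) auto
  qed
  show ?thesis
  proof (rule V.ideal2I[of "monom c2 m" "monom c1 m"])
    show "monom c (Suc m) = v * monom c2 m + u * monom c1 m"
      by (subst c) (simp add: u_def v_def mult_monom add_monom)
  qed (auto intro: monom_in_V c1_deg c2_deg)
qed

lemma mem_params_ideal_iff:
  assumes "p \<in> V"
  shows "p \<in> V.ideal2 v u \<longleftrightarrow> linear_part_in_params p"
proof
  assume "p \<in> V.ideal2 v u"
  then obtain f g where fg: "f \<in> V" "g \<in> V" "p = f * v + g * u"
    by (elim V.ideal2E) (auto simp: mult.commute)
  then show "linear_part_in_params p"
    using linear_part_in_params_mult linear_part_in_params_add linear_part_in_params_u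
      linear_part_in_params_v by blast
next
  assume p: "linear_part_in_params p"
  have "(\<Sum>m\<le>Polynomial.degree p. monom (coeff p m) m) \<in> V.ideal2 v u"
  proof (rule V.ideal_in_sum)
    show ideal: "V.ideal_in (V.ideal2 v u)"
      by (intro V.ideal_in_ideal2 u_in_V v_in_V)
    fix m
    show "monom (coeff p m) m \<in> V.ideal2 v u"
    proof (cases m)
      case 0
      then show ?thesis using p ideal
        by (simp add: linear_part_in_params_def V.ideal_in_def)
    next
      case (Suc n)
      then show ?thesis using p VD[OF assms, of m]
        by (auto simp: linear_part_in_params_def intro!: monom_in_params_ideal)
    qed
  qed
  then show "p \<in> V.ideal2 v u"
    by (simp add: poly_as_sum_of_monoms)
qed

definition Y :: "'k poly poly" where "Y = [:[:0, 1:]:]"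

lemma prime_Y: "prime_elem Y"
  unfolding Y_def by (simp add: prime_elem_const_poly_iff prime_elem_linear_field_poly)

lemma Y_power: "Y ^ n = [:monom 1 n:]"
  by (induction n) (simp_all add: Y_def monom_altdef one_pCons)

text \<open>Dividing \<open>X^m Y^j\<close> by \<open>v = X Y^k\<close> gives \<open>X^(m-1) Y^(j-k)\<close>. The bound \<open>j \<le> k m\<close> becomes
\<open>j - k \<le> k (m - 1)\<close>, and \<open>k \<le> j \<le> k m\<close> forces \<open>m \<ge> 1\<close>. So only divisibility by \<open>Y^k\<close> has to be checked.\<close>

lemma multiple_of_v:
  assumes "f \<in> V" "Y ^ k dvd f"
  shows "\<exists>g\<in>V. f = v * g"
proof -
  obtain g0 where g0: "f = [:monom 1 k:] * g0"
    using assms(2) by (auto simp: Y_power)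
  have f: "coeff f m = monom 1 k * coeff g0 m" for m
    by (simp add: g0)
  have deg: "coeff g0 m = 0 \<or> k + Polynomial.degree (coeff g0 m) \<le> k * m" for m
    using VD[OF assms(1), of m] unfolding f
    by (cases "coeff g0 m = 0") (auto simp: degree_mult_eq monom_eq_0_iff degree_monom_eq)
  obtain a g where g: "g0 = pCons a g"
    by (cases g0)
  have "a = 0"
    using deg[of 0] k_pos by (simp add: g)
  have "g \<in> V"
    unfolding V_def
  proof (safe)
    fix m
    show "Polynomial.degree (coeff g m) \<le> k * m"
      using deg[of "Suc m"] by (auto simp: g)
  qed
  moreover have "f = v * g"
    unfolding g0 g \<open>a = 0\<close> v_def
    by (simp add: poly_eq_iff coeff_monom_mult coeff_pCons split: nat.splits)
  ultimately show ?thesis by blast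
qed

lemma Y_power_dvd_v: "Y ^ k dvd v"
  unfolding Y_power v_def by (rule dvdI[of _ _ "monom 1 1"]) (simp add: monom_altdef)

lemma not_Y_dvd_u: "\<not> Y dvd u"
proof
  assume "Y dvd u"
  then obtain g where g: "u = Y * g" by blast
  have "poly (coeff u 1) 0 = 0" unfolding g by (simp add: Y_def)
  then show False by (simp add: u_def)
qed

text \<open>As \<open>Y\<close> is prime, \<open>Y^k\<close> dividing \<open>p f\<close> must divide \<open>f\<close>, and then \<open>v\<close> divides \<open>f\<close> within \<open>V\<close>.\<close>

lemma regular_mod_v:
  assumes "p \<in> V" "\<not> Y dvd p"
  shows "V.regular_mod v p"
  unfolding V.regular_mod_def
proof (intro ballI impI)
  fix f g assume fg: "f \<in> V" "g \<in> V" "p * f = v * g"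
  have "Y ^ k dvd p * f"
    unfolding fg(3) by (intro dvd_mult2 Y_power_dvd_v)
  then have "Y ^ k dvd f"
    using prime_Y assms(2) by (metis prime_power_dvd_multD mult.commute k_pos)
  then show "\<exists>h\<in>V. f = v * h"
    using multiple_of_v fg(1) by blast
qed

text \<open>\<open>D\<close> is the complement of the monomial maximal ideal of \<open>V\<close>, \<open>L\<close> the localization and \<open>M\<close> its maximal
ideal. The coefficient of \<open>X^0\<close> of an element of \<open>V\<close> is a constant, so \<open>D\<close> is multiplicative.\<close>

definition D :: "'k poly poly set" where
  "D = {q \<in> V. coeff q 0 \<noteq> 0}"

definition L :: "'k poly poly fract set" where
  "L = {to_fract p / to_fract q | p q. p \<in> V \<and> q \<in> D}"

definition M :: "'k poly poly fract set" where
  "M = {to_fract p / to_fract q | p q. p \<in> V \<and> coeff p 0 = 0 \<and> q \<in> D}"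

lemma D_in_V: "q \<in> D \<Longrightarrow> q \<in> V" and D_nonzero: "q \<in> D \<Longrightarrow> q \<noteq> 0"
  by (auto simp: D_def)

lemma D_mult: "p \<in> D \<Longrightarrow> q \<in> D \<Longrightarrow> p * q \<in> D"
  by (auto simp: D_def V.closed coeff_mult_0)

lemma one_in_D: "1 \<in> D"
  by (simp add: D_def V.closed)

lemma LE:
  assumes "x \<in> L"
  obtains p q where "p \<in> V" "q \<in> D" "x = to_fract p / to_fract q"
  using assms unfolding L_def by blast

lemma LI: "p \<in> V \<Longrightarrow> q \<in> D \<Longrightarrow> to_fract p / to_fract q \<in> L"
  unfolding L_def by blast

lemma to_fract_in_L: "p \<in> V \<Longrightarrow> to_fract p \<in> L"
  using LI[OF _ one_in_D] by simp

lemma inverse_to_fract_in_L: "q \<in> D \<Longrightarrow> inverse (to_fract q) \<in> L"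
  using LI[OF V.one_closed] by (simp add: divide_inverse)

lemma M_iff:
  assumes "p \<in> V" "q \<in> D"
  shows "to_fract p / to_fract q \<in> M \<longleftrightarrow> coeff p 0 = 0"
proof
  assume "to_fract p / to_fract q \<in> M"
  then obtain p' q' where p'q': "p' \<in> V" "coeff p' 0 = 0" "q' \<in> D"
    "to_fract p / to_fract q = to_fract p' / to_fract q'"
    unfolding M_def by blast
  then have "p * q' = p' * q"
    using fract_eq_iff D_nonzero assms by blast
  then have "coeff p 0 * coeff q' 0 = 0"
    using p'q'(2) by (metis coeff_mult_0 mult_zero_left)
  then show "coeff p 0 = 0"
    using p'q'(3) by (simp add: D_def)
qed (use assms in \<open>auto simp: M_def\<close>)

sublocale L: domain_subring L
proof
  fix x y assume "x \<in> L" "y \<in> L"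
  then obtain p q p' q' where pq: "p \<in> V" "q \<in> D" "x = to_fract p / to_fract q"
    "p' \<in> V" "q' \<in> D" "y = to_fract p' / to_fract q'"
    by (elim LE)
  have "x + y = to_fract (p * q' + p' * q) / to_fract (q * q')"
    using D_nonzero pq by (simp add: add_frac_eq)
  also have "\<dots> \<in> L"
    using pq D_in_V[of q] D_in_V[of q'] by (intro LI V.add_closed V.mult_closed D_mult)
  finally show "x + y \<in> L" .
  have "x * y = to_fract (p * p') / to_fract (q * q')"
    using pq by simp
  also have "\<dots> \<in> L"
    using pq by (intro LI V.mult_closed D_mult)
  finally show "x * y \<in> L" .
  have "- x = to_fract (- p) / to_fract q"
    using pq by simp
  also have "\<dots> \<in> L"
    using pq by (intro LI V.uminus_closed)
  finally show "- x \<in> L" .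
qed (use to_fract_in_L[of 0] to_fract_in_L[of 1] V.closed in simp_all)

lemma M_subset: "M \<subseteq> L"
  by (auto simp: M_def L_def)

lemma M_ideal: "L.ideal_in M"
  unfolding L.ideal_in_def
proof (intro conjI ballI M_subset)
  show "0 \<in> M"
    using M_iff[OF V.zero_closed one_in_D] by simp
next
  fix x y assume "x \<in> M" "y \<in> M"
  then obtain p q p' q' where pq: "p \<in> V" "coeff p 0 = 0" "q \<in> D" "x = to_fract p / to_fract q"
    "p' \<in> V" "coeff p' 0 = 0" "q' \<in> D" "y = to_fract p' / to_fract q'"
    unfolding M_def by blast
  have "x + y = to_fract (p * q' + p' * q) / to_fract (q * q')"
    using D_nonzero pq by (simp add: add_frac_eq)
  also have "\<dots> \<in> M"
    using pq D_in_V[of q] D_in_V[of q']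
    by (subst M_iff) (auto intro!: V.closed D_mult simp: coeff_mult_0)
  finally show "x + y \<in> M" .
next
  fix x y assume "x \<in> L" "y \<in> M"
  then obtain p q p' q' where pq: "p \<in> V" "q \<in> D" "x = to_fract p / to_fract q"
    "p' \<in> V" "coeff p' 0 = 0" "q' \<in> D" "y = to_fract p' / to_fract q'"
    unfolding M_def L_def by blast
  have "x * y = to_fract (p * p') / to_fract (q * q')"
    using pq by simp
  also have "\<dots> \<in> M"
    using pq by (subst M_iff) (auto intro!: V.closed D_mult simp: coeff_mult_0)
  finally show "x * y \<in> M" .
qed

lemma one_notin_M: "1 \<notin> M"
  using M_iff[OF V.one_closed one_in_D] by simp

lemma unit_in_L:
  assumes "x \<in> L" "x \<notin> M"
  shows "inverse x \<in> L"
proof -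
  obtain p q where pq: "p \<in> V" "q \<in> D" "x = to_fract p / to_fract q"
    using assms(1) by (elim LE)
  then have "p \<in> D" using assms(2) M_iff by (simp add: D_def)
  then show ?thesis using LI[of q p] pq D_in_V by simp
qed

lemma regular_mod_to_fract:
  assumes reg: "V.regular_mod x p" and V: "x \<in> V" "p \<in> V" and q: "q \<in> D"
  shows "L.regular_mod (to_fract x) (to_fract p / to_fract q)"
  unfolding L.regular_mod_def
proof (intro ballI impI)
  fix f g assume "f \<in> L" "g \<in> L" and eq: "to_fract p / to_fract q * f = to_fract x * g"
  then obtain f1 f2 g1 g2 where fg: "f1 \<in> V" "f2 \<in> D" "f = to_fract f1 / to_fract f2"
    "g1 \<in> V" "g2 \<in> D" "g = to_fract g1 / to_fract g2"
    by (elim LE)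
  have "to_fract (p * f1) / to_fract (q * f2) = to_fract (x * g1) / to_fract g2"
    using eq fg by simp
  then have "p * f1 * g2 = x * g1 * (q * f2)"
    using fract_eq_iff fg q D_nonzero D_mult by metis
  then have "p * (f1 * g2) = x * (g1 * (q * f2))"
    by (simp add: algebra_simps)
  then obtain h where h: "h \<in> V" "f1 * g2 = x * h"
    using V.regular_modD[OF reg, of "f1 * g2" "g1 * (q * f2)"] fg q
    by (auto intro: V.closed D_in_V)
  have "f = to_fract (f1 * g2) / to_fract (f2 * g2)"
    using fg D_nonzero by simp
  then have "f = to_fract x * (to_fract h / to_fract (f2 * g2))"
    unfolding h(2) by simp
  moreover have "to_fract h / to_fract (f2 * g2) \<in> L"
    using h fg by (intro LI D_mult)
  ultimately show "\<exists>h\<in>L. f = to_fract x * h" by blast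
qed

text \<open>The only prime minimal over \<open>(v)\<close>: it corresponds to the exponents off the ray through \<open>a\<close>.\<close>

definition P_v :: "'k poly poly fract set" where
  "P_v = {to_fract p / to_fract q | p q. p \<in> V \<and> q \<in> D \<and> Y dvd p}"

lemma not_Y_dvd_D: "q \<in> D \<Longrightarrow> \<not> Y dvd q"
proof
  assume q: "q \<in> D" "Y dvd q"
  then obtain g where "q = Y * g" by blast
  moreover obtain c where "coeff q 0 = [:c:]"
    using constant_coeff_in_V D_in_V q by blast
  ultimately show False
    using q(1) by (cases "coeff g 0") (auto simp: Y_def D_def)
qed

lemma P_v_iff:
  assumes "p \<in> V" "q \<in> D"
  shows "to_fract p / to_fract q \<in> P_v \<longleftrightarrow> Y dvd p"
proof
  assume "to_fract p / to_fract q \<in> P_v"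
  then obtain p' q' where p'q': "p' \<in> V" "Y dvd p'" "q' \<in> D"
    "to_fract p / to_fract q = to_fract p' / to_fract q'"
    unfolding P_v_def by blast
  then have "p * q' = p' * q"
    using fract_eq_iff D_nonzero assms by blast
  then have "Y dvd p * q'"
    using p'q'(2) by simp
  then show "Y dvd p"
    using prime_Y not_Y_dvd_D[OF p'q'(3)] by (simp add: prime_elem_dvd_mult_iff)
qed (use assms in \<open>auto simp: P_v_def\<close>)

lemma P_v_prime: "L.prime_in P_v"
  unfolding L.prime_in_def L.ideal_in_def
proof (intro conjI ballI impI)
  show "P_v \<subseteq> L"
    by (auto simp: P_v_def L_def)
  show "0 \<in> P_v"
    using P_v_iff[OF V.zero_closed one_in_D] by simp
  have "1 \<notin> P_v"
    using P_v_iff[OF V.one_closed one_in_D] not_Y_dvd_D[OF one_in_D] by simp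
  then show "P_v \<noteq> L"
    using L.one_closed by blast
next
  fix x y assume "x \<in> P_v" "y \<in> P_v"
  then obtain p q p' q' where pq: "p \<in> V" "Y dvd p" "q \<in> D" "x = to_fract p / to_fract q"
    "p' \<in> V" "Y dvd p'" "q' \<in> D" "y = to_fract p' / to_fract q'"
    unfolding P_v_def by blast
  have "x + y = to_fract (p * q' + p' * q) / to_fract (q * q')"
    using D_nonzero pq by (simp add: add_frac_eq)
  also have "\<dots> \<in> P_v"
    using pq D_in_V[of q] D_in_V[of q']
    by (subst P_v_iff) (auto intro!: V.closed D_mult)
  finally show "x + y \<in> P_v" .
next
  fix x y assume "x \<in> L" "y \<in> P_v"
  then obtain p q p' q' where pq: "p \<in> V" "q \<in> D" "x = to_fract p / to_fract q"
    "p' \<in> V" "Y dvd p'" "q' \<in> D" "y = to_fract p' / to_fract q'"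
    unfolding P_v_def L_def by blast
  have "x * y = to_fract (p * p') / to_fract (q * q')"
    using pq by simp
  also have "\<dots> \<in> P_v"
    using pq by (subst P_v_iff) (auto intro!: V.closed D_mult)
  finally show "x * y \<in> P_v" .
next
  fix x y assume "x \<in> L" "y \<in> L" and xy: "x * y \<in> P_v"
  then obtain p q p' q' where pq: "p \<in> V" "q \<in> D" "x = to_fract p / to_fract q"
    "p' \<in> V" "q' \<in> D" "y = to_fract p' / to_fract q'"
    unfolding L_def by blast
  have "x * y = to_fract (p * p') / to_fract (q * q')"
    using pq by simp
  then have "Y dvd p * p'"
    using P_v_iff[of "p * p'" "q * q'"] pq xy by (auto intro: V.closed D_mult)
  then show "x \<in> P_v \<or> y \<in> P_v"
    using prime_Y pq P_v_iff by (auto simp: prime_elem_dvd_mult_iff)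
qed

lemma regular_mod_v_L:
  assumes "x \<in> L" "x \<notin> P_v"
  shows "L.regular_mod (to_fract v) x"
proof -
  obtain p q where pq: "p \<in> V" "q \<in> D" "x = to_fract p / to_fract q"
    using assms(1) by (elim LE)
  then show ?thesis
    using regular_mod_to_fract[OF regular_mod_v v_in_V] P_v_iff assms(2) by auto
qed

lemma power_of_P_v_multiple_of_v:
  assumes "x \<in> P_v"
  shows "\<exists>f\<in>L. x ^ k = to_fract v * f"
proof -
  obtain p q where pq: "p \<in> V" "Y dvd p" "q \<in> D" "x = to_fract p / to_fract q"
    using assms unfolding P_v_def by blast
  have "q ^ n \<in> D" for n
    by (induction n) (auto intro: pq D_mult one_in_D)
  moreover obtain g where "g \<in> V" "p ^ k = v * g"
    using multiple_of_v[OF V.power_closed[OF pq(1)] dvd_power_same[OF pq(2)]] by blast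
  moreover have "x ^ k = to_fract (p ^ k) / to_fract (q ^ k)"
    by (simp add: pq to_fract_power power_divide)
  ultimately show ?thesis
    by (intro bexI[of _ "to_fract g / to_fract (q ^ k)"]) (auto intro: LI)
qed

text \<open>Otherwise \<open>x^k\<close> and \<open>y^k\<close> would both be multiples of the nonunit \<open>v\<close>.\<close>

lemma not_both_in_P_v:
  assumes "L.regular_mod x y" "x \<in> L" "y \<in> L" "x \<noteq> 0" "y \<noteq> 0"
  shows "x \<notin> P_v \<or> y \<notin> P_v"
proof (rule ccontr)
  assume "\<not> ?thesis"
  then obtain f g where "f \<in> L" "g \<in> L" "x ^ k = to_fract v * f" "y ^ k = to_fract v * g"
    using power_of_P_v_multiple_of_v by blast
  then obtain h where h: "h \<in> L" "to_fract v * h = 1"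
    using L.regular_pair_powers_not_common_multiple[OF assms] by blast
  have "to_fract v \<in> M"
    using M_iff[OF v_in_V one_in_D] by (simp add: v_def)
  then show False
    using h M_ideal one_notin_M unfolding L.ideal_in_def by (metis mult.commute)
qed

text \<open>Denominators do not matter: multiplying \<open>p\<close> by an element of \<open>D\<close> scales its constant and linear parts
by the same nonzero constant once the constant part vanishes.\<close>

lemma mem_params_ideal_L_iff:
  assumes "p \<in> V" "q \<in> D"
  shows "to_fract p / to_fract q \<in> L.ideal2 (to_fract v) (to_fract u) \<longleftrightarrow> linear_part_in_params p"
proof
  assume "linear_part_in_params p"
  then obtain f g where fg: "f \<in> V" "g \<in> V" "p = v * f + u * g"
    using mem_params_ideal_iff[OF assms(1)] by (metis V.ideal2E)
  show "to_fract p / to_fract q \<in> L.ideal2 (to_fract v) (to_fract u)"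
    by (rule L.ideal2I[of "to_fract f / to_fract q" "to_fract g / to_fract q"])
      (auto simp: fg add_divide_distrib intro: LI assms)
next
  assume "to_fract p / to_fract q \<in> L.ideal2 (to_fract v) (to_fract u)"
  then obtain f g where fgL: "f \<in> L" "g \<in> L"
    and eq: "to_fract p / to_fract q = to_fract v * f + to_fract u * g"
    by (metis L.ideal2E)
  then obtain f1 f2 g1 g2 where fg: "f1 \<in> V" "f2 \<in> D" "f = to_fract f1 / to_fract f2"
    "g1 \<in> V" "g2 \<in> D" "g = to_fract g1 / to_fract g2"
    by (metis LE)
  have "to_fract p / to_fract q
      = to_fract v * to_fract f1 / to_fract f2 + to_fract u * to_fract g1 / to_fract g2"
    unfolding eq using fg by simp
  also have "\<dots> = (to_fract v * to_fract f1 * to_fract g2 + to_fract u * to_fract g1 * to_fract f2)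
      / (to_fract f2 * to_fract g2)"
    using fg D_nonzero by (intro add_frac_eq) simp_all
  also have "\<dots> = to_fract (g2 * f1 * v + f2 * g1 * u) / to_fract (f2 * g2)"
    by (simp add: mult_ac)
  finally have "to_fract p / to_fract q
      = to_fract (g2 * f1 * v + f2 * g1 * u) / to_fract (f2 * g2)" .
  then have "p * (f2 * g2) = (g2 * f1 * v + f2 * g1 * u) * q"
    using fract_eq_iff fg assms D_nonzero D_mult by metis
  moreover have "linear_part_in_params (q * (g2 * f1 * v + f2 * g1 * u))"
    using fg assms
      D_in_V[of q] D_in_V[of f2] D_in_V[of g2]
    by (intro linear_part_in_params_mult linear_part_in_params_add linear_part_in_params_u
        linear_part_in_params_v V.mult_closed)
  moreover define s where "s = f2 * g2"
  ultimately have lin: "linear_part_in_params (p * s)"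
    by (simp add: mult.commute)
  have s: "s \<in> D" unfolding s_def using fg D_mult by blast
  obtain c where c0: "coeff s 0 = [:c:]"
    using constant_coeff_in_V[OF D_in_V[OF s]] .
  with s have c: "coeff s 0 = [:c:]" "c \<noteq> 0"
    by (auto simp: D_def)
  have "coeff p 0 * [:c:] = 0"
    using lin by (simp add: linear_part_in_params_def coeff_mult_0 c(1))
  then have p0: "coeff p 0 = 0"
    using c(2) by simp
  have "coeff (p * s) 1 = smult c (coeff p 1)"
    by (simp add: coeff_Suc_0_mult c(1) p0)
  then show "linear_part_in_params p"
    using lin c(2) p0 unfolding linear_part_in_params_def by simp
qed

lemma common_denominator:
  fixes n :: nat
  assumes "\<forall>i<n. c i \<in> L"
  shows "\<exists>q\<in>D. \<forall>i<n. \<exists>p\<in>V. c i = to_fract p / to_fract q"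
  using assms
proof (induction n)
  case 0
  then show ?case using one_in_D by auto
next
  case (Suc n)
  then obtain q where q: "q \<in> D" "\<forall>i<n. \<exists>p\<in>V. c i = to_fract p / to_fract q"
    by auto
  have "c n \<in> L"
    using Suc.prems by simp
  then obtain p' q' where p'q': "p' \<in> V" "q' \<in> D" "c n = to_fract p' / to_fract q'"
    by (elim LE)
  have "\<exists>p\<in>V. c i = to_fract p / to_fract (q * q')" if "i < Suc n" for i
  proof (cases "i = n")
    case True
    then show ?thesis
      using p'q' q(1) D_nonzero D_in_V by (intro bexI[of _ "p' * q"]) (auto intro: V.closed)
  next
    case False
    with that have "i < n" by simp
    then obtain p where p: "p \<in> V" "c i = to_fract p / to_fract q"
      using q by blast
    then show ?thesis
      using p'q' D_nonzero D_in_V by (intro bexI[of _ "p * q'"]) (auto intro: V.closed)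
  qed
  then show ?case using D_mult[OF q(1) p'q'(2)] by blast
qed

text \<open>The images \<open>X Y^(i+1)\<close> of the generators \<open>a + (i+1) d\<close> off the two extremal rays; they are indexed
from \<open>0\<close> to \<open>k - 2\<close>.\<close>

definition interior_generator :: "nat \<Rightarrow> 'k poly poly" where
  "interior_generator i = monom (monom 1 (Suc i)) 1"

lemma interior_generator_in_V: "i < k - 1 \<Longrightarrow> interior_generator i \<in> V"
  unfolding interior_generator_def
  by (intro monom_in_V) (simp add: degree_monom_eq)

lemma coeff_interior_combination:
  "coeff (\<Sum>i<n. p i * interior_generator i) 0 = 0"
  "coeff (\<Sum>i<n. p i * interior_generator i) 1 = (\<Sum>i<n. coeff (p i) 0 * monom 1 (Suc i))"
  by (simp_all add: coeff_sum interior_generator_def coeff_mult_0 coeff_Suc_0_mult)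

text \<open>Modulo \<open>(v, u)\<close> an element of \<open>V\<close> is a constant plus a combination of the \<open>X Y^(i+1)\<close>, and the latter
are killed by \<open>M\<close>, since a product with them starts in degree two. Conversely, multiplying an element
of the socle by \<open>X Y\<close> puts its constant term in front of \<open>X Y\<close>, which is not in \<open>(v, u)\<close> as \<open>1 < k\<close>, so
the constant term vanishes.\<close>

lemma socle_basis_params:
  "L.socle_basis_in M (L.ideal2 (to_fract v) (to_fract u)) (k - 1) (\<lambda>i. to_fract (interior_generator i))"
  unfolding L.socle_basis_in_def
proof (intro conjI allI impI ballI)
  fix i assume i: "i < k - 1"
  show "to_fract (interior_generator i) \<in> L"
    using i by (intro to_fract_in_L interior_generator_in_V)
  fix r assume "r \<in> M"
  then obtain p q where pq: "p \<in> V" "coeff p 0 = 0" "q \<in> D" "r = to_fract p / to_fract q"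
    unfolding M_def by blast
  have "linear_part_in_params (p * interior_generator i)"
    using pq(2) by (simp add: linear_part_in_params_def coeff_mult_0 coeff_Suc_0_mult
        interior_generator_def)
  then show "r * to_fract (interior_generator i) \<in> L.ideal2 (to_fract v) (to_fract u)"
    using mem_params_ideal_L_iff[of "p * interior_generator i" q] pq interior_generator_in_V[OF i]
    by (simp add: V.closed)
next
  fix z assume "z \<in> L" and socle: "\<forall>r\<in>M. r * z \<in> L.ideal2 (to_fract v) (to_fract u)"
  then obtain p q where pq: "p \<in> V" "q \<in> D" "z = to_fract p / to_fract q"
    by (metis LE)
  let ?t = "interior_generator 0"
  have t: "?t \<in> V" using two_le_k by (intro interior_generator_in_V) simp
  then have "to_fract ?t \<in> M"
    using M_iff[OF _ one_in_D] by (simp add: interior_generator_def)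
  then have "to_fract (?t * p) / to_fract q \<in> L.ideal2 (to_fract v) (to_fract u)"
    using socle pq(3) by auto
  then have lin: "linear_part_in_params (?t * p)"
    using mem_params_ideal_L_iff V.closed t pq by blast
  obtain c where c: "coeff p 0 = [:c:]"
    using constant_coeff_in_V[OF pq(1)] .
  have "coeff (coeff (?t * p) 1) 1 = c"
    by (simp add: coeff_Suc_0_mult interior_generator_def c smult_monom)
  then have p0: "coeff p 0 = 0"
    using lin two_le_k c by (simp add: linear_part_in_params_def)
  let ?c = "\<lambda>i. coeff (coeff p 1) (Suc i)"
  let ?p = "\<lambda>i. [:[:?c i:]:]"
  have pV: "?p i \<in> V" for i
    by (simp add: V_def coeff_pCons split: nat.split)
  let ?r = "p - (\<Sum>i<k-1. ?p i * interior_generator i)"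
  let ?s = "\<Sum>i<k-1. ?p i * interior_generator i"
  have r0: "coeff ?r 0 = 0"
    unfolding coeff_diff coeff_interior_combination(1) p0 by simp
  have s1: "coeff (coeff ?s 1) (Suc j) = ?c j" if "Suc j < k" for j
    unfolding coeff_interior_combination using that
    by (simp add: coeff_sum smult_monom if_distrib cong: if_cong)
  have "linear_part_in_params ?r"
    unfolding linear_part_in_params_def
  proof (intro conjI allI impI r0)
    fix j assume "0 < j \<and> j < k"
    then obtain i where "j = Suc i" "Suc i < k"
      by (cases j) auto
    then show "coeff (coeff ?r 1) j = 0"
      using s1[of i] by (simp only: coeff_diff) simp
  qed
  moreover have "?r \<in> V"
    using pV pq(1) by (intro V.closed interior_generator_in_V) auto
  ultimately have "to_fract ?r / to_fract q \<in> L.ideal2 (to_fract v) (to_fract u)"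
    using mem_params_ideal_L_iff pq(2) by blast
  moreover have "to_fract ?r / to_fract q
      = z - (\<Sum>i<k-1. to_fract (?p i) / to_fract q * to_fract (interior_generator i))"
    unfolding pq(3) to_fract_diff to_fract_sum to_fract_mult diff_divide_distrib sum_divide_distrib
    by simp
  ultimately show "\<exists>c. (\<forall>i<k - 1. c i \<in> L) \<and>
      z - (\<Sum>i<k - 1. c i * to_fract (interior_generator i)) \<in> L.ideal2 (to_fract v) (to_fract u)"
    using pV pq(2) by (intro exI[of _ "\<lambda>i. to_fract (?p i) / to_fract q"]) (auto intro: LI)
next
  fix c j assume c: "\<forall>i<k - 1. c i \<in> L" and j: "j < k - 1"
    and in_I: "(\<Sum>i<k - 1. c i * to_fract (interior_generator i)) \<in> L.ideal2 (to_fract v) (to_fract u)"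
  obtain q where q: "q \<in> D" "\<forall>i<k-1. \<exists>p\<in>V. c i = to_fract p / to_fract q"
    using common_denominator[OF c] by blast
  then obtain p where p: "\<And>i. i < k - 1 \<Longrightarrow> p i \<in> V" 
    "\<And>i. i < k - 1 \<Longrightarrow> c i = to_fract (p i) / to_fract q"
    by metis
  let ?s = "\<Sum>i<k-1. p i * interior_generator i"
  have "(\<Sum>i<k - 1. c i * to_fract (interior_generator i)) = to_fract ?s / to_fract q"
    by (simp add: to_fract_sum sum_divide_distrib p(2))
  moreover have "?s \<in> V"
    by (intro V.closed interior_generator_in_V p) auto
  ultimately have lin: "linear_part_in_params ?s"
    using mem_params_ideal_L_iff q(1) in_I by metis
  have "\<forall>i. \<exists>e. i < k - 1 \<longrightarrow> coeff (p i) 0 = [:e:]"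
    using constant_coeff_in_V p(1) by metis
  then obtain e where e: "\<And>i. i < k - 1 \<Longrightarrow> coeff (p i) 0 = [:e i:]"
    by metis
  have "coeff (coeff ?s 1) (Suc j) = coeff (\<Sum>i<k-1. [:e i:] * monom 1 (Suc i)) (Suc j)"
    unfolding coeff_interior_combination using e by (intro arg_cong2[of _ _ _ _ coeff] sum.cong) auto
  also have "\<dots> = e j"
    using j by (simp only: coeff_sum_constants if_True)
  finally have "e j = 0"
    using lin j by (simp add: linear_part_in_params_def)
  then show "c j \<in> M"
    using M_iff p e j q(1) by simp
qed

lemma params_in_M: "to_fract u \<in> M" "to_fract v \<in> M"
  using M_iff[OF u_in_V one_in_D] M_iff[OF v_in_V one_in_D] by (simp_all add: u_def v_def)

lemma regular_mod_v_u: "L.regular_mod (to_fract v) (to_fract u)"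
  using regular_mod_to_fract[OF regular_mod_v[OF u_in_V not_Y_dvd_u] v_in_V u_in_V one_in_D] by simp

text \<open>The exchange steps \<open>(v, u) \<rightarrow> (v, y) = (y, v) \<rightarrow> (y, x) = (x, y)\<close> need \<open>y\<close> to be regular modulo \<open>v\<close>,
that is \<open>y \<notin> P_v\<close>. If \<open>y \<in> P_v\<close>, then \<open>x \<notin> P_v\<close> and the roles of \<open>x\<close> and \<open>y\<close> are interchanged.\<close>

theorem socle_basis_exists:
  assumes reg: "L.regular_mod x y" and M: "x \<in> M" "y \<in> M" and "x \<noteq> 0"
  shows "\<exists>b. L.socle_basis_in M (L.ideal2 x y) (k - 1) b"
proof -
  let ?has_basis = "\<lambda>x y. \<exists>b. L.socle_basis_in M (L.ideal2 x y) (k - 1) b"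
  let ?u = "to_fract u" and ?v = "to_fract v"
  have L: "x \<in> L" "y \<in> L" "?u \<in> L" "?v \<in> L"
    using M M_subset params_in_M by auto
  have "y \<noteq> 0"
  proof
    assume "y = 0"
    then obtain h where "h \<in> L" "1 = x * h"
      using L.regular_modD[OF reg L.one_closed L.zero_closed] by auto
    then show False
      using M_ideal M(1) one_notin_M unfolding L.ideal_in_def by (metis mult.commute)
  qed
  have step: "?has_basis x y"
    if y: "y \<notin> P_v" and xy: "L.regular_mod x y" "x \<in> M" "y \<in> M" "x \<noteq> 0" for x y
  proof -
    have inL: "x \<in> L" "y \<in> L" using xy M_subset by auto
    have v_y: "L.regular_mod ?v y"
      using regular_mod_v_L[OF inL(2) y] .
    then have y_v: "L.regular_mod y ?v"
      using L.regular_mod_swap v_nonzero by auto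
    have "?has_basis ?v ?u" using socle_basis_params by blast
    then have "?has_basis ?v y"
      using L.socle_basis_exchange[OF regular_mod_v_u v_y] L inL M_subset params_in_M xy by blast
    then have "?has_basis y ?v" by (simp only: L.ideal2_commute)
    then have "?has_basis y x"
      using L.socle_basis_exchange[OF y_v L.regular_mod_swap[OF xy(1,4)]] L inL M_subset
        params_in_M xy by blast
    then show ?thesis by (simp only: L.ideal2_commute)
  qed
  show ?thesis
  proof (cases "y \<in> P_v")
    case True
    then have "x \<notin> P_v"
      using not_both_in_P_v[OF reg L(1,2) \<open>x \<noteq> 0\<close> \<open>y \<noteq> 0\<close>] by blast
    then have "?has_basis y x"
      using step[OF _ L.regular_mod_swap[OF reg \<open>x \<noteq> 0\<close>]] M \<open>y \<noteq> 0\<close> by blast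
    then show ?thesis by (simp only: L.ideal2_commute)
  next
    case False
    then show ?thesis using step assms by blast
  qed
qed

end

section \<open>The Noetherian property\<close>

text \<open>Fix one element \<open>(a0, b0)\<close>. An element not above it has first entry below \<open>a0\<close> or second entry below
\<open>b0\<close>; for each of these finitely many rows and columns, the smallest element suffices.\<close>

lemma dickson_nat2:
  fixes E :: "(nat \<times> nat) set"
  shows "\<exists>F\<subseteq>E. finite F \<and> (\<forall>a b. (a, b) \<in> E \<longrightarrow> (\<exists>c d. (c, d) \<in> F \<and> c \<le> a \<and> d \<le> b))"
proof (cases "E = {}")
  case False
  then obtain a0 b0 where ab0: "(a0, b0) \<in> E" by auto
  let ?A = "(\<lambda>a. (a, LEAST b. (a, b) \<in> E)) ` {a. a < a0 \<and> (\<exists>b. (a, b) \<in> E)}"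
  let ?B = "(\<lambda>b. (LEAST a. (a, b) \<in> E, b)) ` {b. b < b0 \<and> (\<exists>a. (a, b) \<in> E)}"
  let ?F = "insert (a0, b0) (?A \<union> ?B)"
  have "?F \<subseteq> E"
    using ab0 by (auto intro: LeastI)
  moreover have "finite ?F" by auto
  moreover have "\<exists>c d. (c, d) \<in> ?F \<and> c \<le> a \<and> d \<le> b" if "(a, b) \<in> E" for a b
  proof -
    consider "a0 \<le> a \<and> b0 \<le> b" | "a < a0" | "b < b0" by linarith
    then show ?thesis
    proof cases
      case 2
      then have "(a, LEAST b. (a, b) \<in> E) \<in> ?F" "(LEAST b. (a, b) \<in> E) \<le> b"
        using that by (auto intro: Least_le)
      then show ?thesis by blast
    next
      case 3
      then have "(LEAST a. (a, b) \<in> E, b) \<in> ?F" "(LEAST a. (a, b) \<in> E) \<le> a"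
        using that by (auto intro: Least_le)
      then show ?thesis by blast
    qed auto
  qed
  ultimately show ?thesis by blast
qed auto

context cone_over_normal_curve
begin

text \<open>The leading exponent of \<open>p\<close>, for the lexicographic order with \<open>X\<close> first, is the pair of the degree and
the degree of the leading coefficient. The hypotheses say that the leading monomial of \<open>g\<close> divides
that of \<open>p\<close> within \<open>V\<close>; adding them gives \<open>k * degree g \<le> k * degree p\<close>.\<close>

lemma cancel_leading_term:
  assumes p: "p \<in> V" "p \<noteq> 0" and g: "g \<in> V" "g \<noteq> 0"
    and j: "Polynomial.degree (lead_coeff g) \<le> Polynomial.degree (lead_coeff p)"
    and co_j: "k * Polynomial.degree g - Polynomial.degree (lead_coeff g)
      \<le> k * Polynomial.degree p - Polynomial.degree (lead_coeff p)"
  shows "\<exists>t\<in>V. p - t * g = 0 \<or> Polynomial.degree (p - t * g) < Polynomial.degree p \<or>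
    Polynomial.degree (p - t * g) = Polynomial.degree p \<and>
    Polynomial.degree (lead_coeff (p - t * g)) < Polynomial.degree (lead_coeff p)"
proof -
  let ?m = "Polynomial.degree" and ?j = "\<lambda>p. Polynomial.degree (lead_coeff p)"
  have jp: "?j p \<le> k * ?m p" and jg: "?j g \<le> k * ?m g"
    using VD p g by auto
  have m: "?m g \<le> ?m p"
  proof -
    have "k * ?m g \<le> k * ?m p" using j co_j jp jg by linarith
    then show ?thesis using k_pos by simp
  qed
  define a where "a = lead_coeff (lead_coeff p) / lead_coeff (lead_coeff g)"
  have "a \<noteq> 0" using p g by (simp add: a_def)
  define t where "t = monom (monom a (?j p - ?j g)) (?m p - ?m g)"
  have "?j p - ?j g \<le> k * (?m p - ?m g)"
    using j co_j jp jg m by (simp add: diff_mult_distrib2)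
  then have "t \<in> V"
    unfolding t_def by (intro monom_in_V) (use degree_monom_le order_trans in blast)
  have "t \<noteq> 0" using \<open>a \<noteq> 0\<close> by (simp add: t_def monom_eq_0_iff)
  have deg_tg: "?m (t * g) = ?m p"
    using \<open>t \<noteq> 0\<close> g(2) m \<open>a \<noteq> 0\<close> by (simp add: degree_mult_eq t_def degree_monom_eq monom_eq_0_iff)
  have lc_tg: "coeff (t * g) (?m p) = monom a (?j p - ?j g) * lead_coeff g"
    unfolding t_def using m by (simp add: coeff_monom_mult)
  have j_tg: "Polynomial.degree (coeff (t * g) (?m p)) = ?j p"
    unfolding lc_tg using j g(2) \<open>a \<noteq> 0\<close> by (subst degree_mult_eq) (auto simp: degree_monom_eq monom_eq_0_iff)
  have lclc_tg: "coeff (coeff (t * g) (?m p)) (?j p) = lead_coeff (lead_coeff p)"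
    unfolding lc_tg coeff_monom_mult using j g(2) by (simp add: a_def)
  let ?r = "p - t * g"
  have "?m ?r < ?m p \<or> ?m ?r = ?m p \<and> ?j ?r < ?j p" if "?r \<noteq> 0"
  proof (cases "?m ?r < ?m p")
    case False
    then have eq: "?m ?r = ?m p"
      using degree_diff_le_max[of p "t * g"] deg_tg by simp
    let ?c = "coeff ?r (?m p)"
    have "?c \<noteq> 0" using that eq by (metis leading_coeff_0_iff)
    have le: "Polynomial.degree ?c \<le> ?j p"
      using degree_diff_le_max[of "lead_coeff p" "coeff (t * g) (?m p)"] j_tg by simp
    have "coeff ?c (?j p) = 0" using lclc_tg by simp
    then have "Polynomial.degree ?c \<noteq> ?j p"
      using \<open>?c \<noteq> 0\<close> by (metis leading_coeff_0_iff)
    then show ?thesis using eq le by simp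
  qed simp
  then show ?thesis using \<open>t \<in> V\<close> by blast
qed

text \<open>Dickson's lemma gives finitely many elements of \<open>I\<close> whose leading monomials divide, within \<open>V\<close>, all
leading monomials of \<open>I\<close>. Division by them terminates because the lexicographic order is well-founded.
Finite generation is phrased by comparison with all ideals \<open>J\<close>, which avoids linear combinations.\<close>

lemma V_noetherian:
  assumes I: "V.ideal_in I"
  shows "\<exists>X\<subseteq>I. finite X \<and> (\<forall>J. V.ideal_in J \<longrightarrow> X \<subseteq> J \<longrightarrow> I \<subseteq> J)"
proof -
  let ?m = "Polynomial.degree" and ?j = "\<lambda>p. Polynomial.degree (lead_coeff p)"
  let ?e = "\<lambda>p. (?j p, k * ?m p - ?j p)"
  obtain F where F: "F \<subseteq> ?e ` (I - {0})" "finite F"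
    "\<And>a b. (a, b) \<in> ?e ` (I - {0}) \<Longrightarrow> \<exists>c d. (c, d) \<in> F \<and> c \<le> a \<and> d \<le> b"
    using dickson_nat2[of "?e ` (I - {0})"] by blast
  then obtain X where X: "X \<subseteq> I - {0}" "finite X" "F = ?e ` X"
    by (meson finite_subset_image)
  have "I \<subseteq> J" if J: "V.ideal_in J" "X \<subseteq> J" for J
  proof
    fix p assume "p \<in> I"
    then show "p \<in> J"
    proof (induction "(?m p, ?j p)" arbitrary: p rule: wf_induct_rule[OF wf_lex_prod[OF wf_less_than wf_less_than]])
      case (1 p)
      show ?case
      proof (cases "p = 0")
        case True
        then show ?thesis using J by (simp add: V.ideal_in_def)
      next
        case False
        then have "\<exists>c d. (c, d) \<in> F \<and> c \<le> ?j p \<and> d \<le> k * ?m p - ?j p"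
          using F(3)[of "?j p" "k * ?m p - ?j p"] \<open>p \<in> I\<close> by blast
        then obtain g where g: "g \<in> X" "?j g \<le> ?j p" "k * ?m g - ?j g \<le> k * ?m p - ?j p"
          unfolding X(3) by auto
        have V: "p \<in> V" "g \<in> V" "g \<noteq> 0" and gI: "g \<in> I"
          using I X g(1) \<open>p \<in> I\<close> by (auto simp: V.ideal_in_def)
        obtain t where t: "t \<in> V" "p - t * g = 0 \<or> ?m (p - t * g) < ?m p \<or>
            ?m (p - t * g) = ?m p \<and> ?j (p - t * g) < ?j p"
          using cancel_leading_term[OF V(1) False V(2,3) g(2,3)] by blast
        have "t * g \<in> J" "t * g \<in> I"
          using J I g(1) gI t(1) by (auto simp: V.ideal_in_def)
        have "p - t * g \<in> J"
        proof (cases "p - t * g = 0")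
          case True
          then show ?thesis using J by (simp add: V.ideal_in_def)
        next
          case False
          have "p - t * g \<in> I"
            using V.ideal_in_diff[OF I \<open>p \<in> I\<close> \<open>t * g \<in> I\<close>] .
          then show ?thesis using 1(1) t(2) False by auto
        qed
        then have "(p - t * g) + t * g \<in> J"
          using J \<open>t * g \<in> J\<close> unfolding V.ideal_in_def by blast
        then show ?thesis by simp
      qed
    qed
  qed
  then show ?thesis using X by blast
qed

lemma contraction_ideal:
  assumes "L.ideal_in J"
  shows "V.ideal_in {p \<in> V. to_fract p \<in> J}"
  using assms to_fract_in_L by (auto simp: V.ideal_in_def L.ideal_in_def intro: V.closed)

lemma numerator_mem_iff:
  assumes "L.ideal_in J" "p \<in> V" "q \<in> D"
  shows "to_fract p / to_fract q \<in> J \<longleftrightarrow> to_fract p \<in> J"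
proof
  assume "to_fract p / to_fract q \<in> J"
  then have "to_fract q * (to_fract p / to_fract q) \<in> J"
    using assms to_fract_in_L D_in_V unfolding L.ideal_in_def by blast
  then show "to_fract p \<in> J"
    using D_nonzero[OF assms(3)] by simp
next
  assume "to_fract p \<in> J"
  then have "inverse (to_fract q) * to_fract p \<in> J"
    using assms inverse_to_fract_in_L unfolding L.ideal_in_def by blast
  then show "to_fract p / to_fract q \<in> J"
    by (simp add: divide_inverse mult.commute)
qed

text \<open>An ideal of a localization is generated by the numerators of its elements.\<close>

theorem L_noetherian:
  assumes I: "L.ideal_in I"
  shows "\<exists>X\<subseteq>I. finite X \<and> (\<forall>J. L.ideal_in J \<longrightarrow> X \<subseteq> J \<longrightarrow> I \<subseteq> J)"
proof -
  obtain X where X: "X \<subseteq> {p \<in> V. to_fract p \<in> I}" "finite X"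
    "\<And>J. V.ideal_in J \<Longrightarrow> X \<subseteq> J \<Longrightarrow> {p \<in> V. to_fract p \<in> I} \<subseteq> J"
    using V_noetherian[OF contraction_ideal[OF I]] by blast
  have "I \<subseteq> J" if J: "L.ideal_in J" "to_fract ` X \<subseteq> J" for J
  proof
    fix x assume "x \<in> I"
    moreover from this obtain p q where pq: "p \<in> V" "q \<in> D" "x = to_fract p / to_fract q"
      using I unfolding L.ideal_in_def by (metis LE subsetD)
    ultimately have "p \<in> {p \<in> V. to_fract p \<in> I}"
      using numerator_mem_iff[OF I] by simp
    moreover have "X \<subseteq> {p \<in> V. to_fract p \<in> J}"
      using X(1) J(2) by blast
    ultimately have "to_fract p \<in> J"
      using X(3)[OF contraction_ideal[OF J(1)]] by blast
    then show "x \<in> J"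
      using numerator_mem_iff[OF J(1)] pq by simp
  qed
  then show ?thesis using X by (intro exI[of _ "to_fract ` X"]) auto
qed

end

section \<open>Chains of primes\<close>

lemma (in vector_space) dependent_family:
  assumes "finite I" "finite T" "card T < card I" "v ` I \<subseteq> span T"
  shows "\<exists>c. (\<exists>i\<in>I. c i \<noteq> 0) \<and> (\<Sum>i\<in>I. scale (c i) (v i)) = 0"
proof (cases "inj_on v I")
  case True
  have "dependent (v ` I)"
    using independent_span_bound[OF assms(2) _ assms(4)] assms(3) card_image[OF True] by auto
  then obtain c where "\<exists>x\<in>v ` I. c x \<noteq> 0" "(\<Sum>x\<in>v ` I. scale (c x) x) = 0"
    using dependent_finite[of "v ` I"] assms(1) by auto
  then show ?thesis
    using True by (intro exI[of _ "c \<circ> v"]) (auto simp: sum.reindex)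
next
  case False
  then obtain i j where ij: "i \<in> I" "j \<in> I" "i \<noteq> j" "v i = v j"
    by (auto simp: inj_on_def)
  let ?c = "\<lambda>l. if l = i then 1 else if l = j then -1 else 0"
  have "(\<Sum>l\<in>I. scale (?c l) (v l)) = (\<Sum>l\<in>{i, j}. scale (?c l) (v l))"
    using assms(1) ij by (intro sum.mono_neutral_right) auto
  also have "\<dots> = 0" using ij by simp
  finally show ?thesis using ij(1) by (intro exI[of _ ?c]) auto
qed

definition bidegree_le :: "nat \<Rightarrow> 'a::comm_semiring_0 poly poly \<Rightarrow> bool" where
  "bidegree_le n p \<longleftrightarrow> Polynomial.degree p \<le> n \<and> (\<forall>m. Polynomial.degree (coeff p m) \<le> n)"

lemma bidegree_le_mono: "bidegree_le m p \<Longrightarrow> m \<le> n \<Longrightarrow> bidegree_le n p"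
  unfolding bidegree_le_def by (meson order_trans)

lemma bidegree_le_exists: "\<exists>n. bidegree_le n p"
proof
  let ?s = "\<Sum>m\<le>Polynomial.degree p. Polynomial.degree (coeff p m)"
  have "Polynomial.degree (coeff p m) \<le> ?s" for m
  proof (cases "m \<le> Polynomial.degree p")
    case True
    then show ?thesis by (intro member_le_sum) auto
  qed (simp add: coeff_eq_0)
  then show "bidegree_le (Polynomial.degree p + ?s) p"
    unfolding bidegree_le_def by (simp add: trans_le_add2)
qed

lemma bidegree_le_mult:
  assumes "bidegree_le m p" "bidegree_le n q"
  shows "bidegree_le (m + n) (p * q)"
  unfolding bidegree_le_def
proof (intro conjI allI)
  show "Polynomial.degree (p * q) \<le> m + n"
    using degree_mult_le[of p q] assms unfolding bidegree_le_def by linarith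
  fix l
  show "Polynomial.degree (coeff (p * q) l) \<le> m + n"
    unfolding coeff_mult
  proof (rule degree_sum_le)
    fix i
    show "Polynomial.degree (coeff p i * coeff q (l - i)) \<le> m + n"
      using degree_mult_le[of "coeff p i" "coeff q (l - i)"] assms unfolding bidegree_le_def
      by (meson add_le_mono order_trans)
  qed simp
qed

lemma bidegree_le_power:
  assumes "bidegree_le n (p :: 'a::comm_semiring_1 poly poly)"
  shows "bidegree_le (e * n) (p ^ e)"
proof (induction e)
  case 0
  then show ?case by (simp add: bidegree_le_def)
next
  case (Suc e)
  then show ?case using bidegree_le_mult[OF assms Suc.IH] by simp
qed

text \<open>The \<open>N^3\<close> products of powers below \<open>N\<close> have bidegree at most \<open>b = 3 (N - 1) d\<close>, so they lie in a space
of dimension \<open>(b + 1)^2 \<le> 9 d^2 N^2\<close>. This is less than \<open>N^3\<close> as soon as \<open>N > 9 d^2\<close>.\<close>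

lemma algebraically_dependent_three:
  fixes f1 f2 f3 :: "'k::field poly poly"
  obtains N c where "(\<Sum>i<N. (\<Sum>j<N. (\<Sum>l<N. [:[:c i j l:]:] * f3 ^ l) * f2 ^ j) * f1 ^ i) = 0"
    and "\<exists>i<N. \<exists>j<N. \<exists>l<N. c i j l \<noteq> (0::'k)"
proof -
  interpret vs: vector_space "\<lambda>(c::'k) (p::'k poly poly). smult [:c:] p"
    by standard (simp_all add: poly_eq_iff algebra_simps)
  obtain n1 n2 n3 where n: "bidegree_le n1 f1" "bidegree_le n2 f2" "bidegree_le n3 f3"
    using bidegree_le_exists by metis
  define d where "d = n1 + n2 + n3 + 1"
  have d: "bidegree_le d f1" "bidegree_le d f2" "bidegree_le d f3" "d \<ge> 1"
    using n by (auto simp: d_def elim: bidegree_le_mono)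
  define N where "N = 9 * d ^ 2 + 1"
  define b where "b = 3 * (N - 1) * d"
  let ?I = "{..<N} \<times> {..<N} \<times> {..<N}"
  let ?v = "\<lambda>(i, j, l). f3 ^ l * f2 ^ j * f1 ^ i"
  let ?T = "(\<lambda>(m, j). monom (monom (1::'k) j) m) ` ({..b} \<times> {..b})"
  have "card ?T < card ?I"
  proof -
    have "card ?T \<le> card ({..b} \<times> {..b})"
      by (rule card_image_le) simp
    also have "\<dots> = (b + 1) ^ 2" by (simp add: card_cartesian_product power2_eq_square)
    also have "\<dots> \<le> (3 * N * d) ^ 2"
    proof (rule power_mono)
      have "N \<ge> 1" by (simp add: N_def)
      then have "3 * N * d = b + 3 * d"
        unfolding b_def by (cases N) (auto simp: algebra_simps)
      then show "b + 1 \<le> 3 * N * d" using d by linarith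
    qed simp
    also have "\<dots> = N ^ 2 * (9 * d ^ 2)" by (simp add: power_mult_distrib)
    also have "\<dots> < N ^ 2 * N" by (simp add: N_def)
    also have "\<dots> = card ?I" by (simp add: card_cartesian_product power2_eq_square)
    finally show ?thesis .
  qed
  moreover have "?v ` ?I \<subseteq> vs.span ?T"
  proof
    fix p assume "p \<in> ?v ` ?I"
    then obtain i j l where ijl: "i < N" "j < N" "l < N" "p = f3 ^ l * f2 ^ j * f1 ^ i"
      by auto
    have "bidegree_le (l * d + j * d + i * d) p"
      unfolding ijl(4) by (intro bidegree_le_mult bidegree_le_power d)
    moreover have "l * d + j * d + i * d \<le> b"
    proof -
      have "l * d + j * d + i * d = (l + j + i) * d" by (simp add: algebra_simps)
      also have "\<dots> \<le> b" unfolding b_def using ijl by (intro mult_right_mono) auto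
      finally show ?thesis .
    qed
    ultimately have p: "bidegree_le b p" by (rule bidegree_le_mono)
    have c: "coeff p m = (\<Sum>j\<le>b. monom (coeff (coeff p m) j) j)" for m
      using p poly_as_sum_of_monoms'[of "coeff p m" b] by (simp add: bidegree_le_def)
    have "p = (\<Sum>m\<le>b. monom (coeff p m) m)"
      using p poly_as_sum_of_monoms'[of p b] by (simp add: bidegree_le_def)
    also have "\<dots> = (\<Sum>m\<le>b. monom (\<Sum>j\<le>b. monom (coeff (coeff p m) j) j) m)"
      by (subst c) (rule refl)
    also have "\<dots> = (\<Sum>m\<le>b. \<Sum>j\<le>b. smult [:coeff (coeff p m) j:] (monom (monom 1 j) m))"
      by (intro sum.cong refl) (simp add: monom_sum smult_monom)
    also have "\<dots> \<in> vs.span ?T"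
      by (intro vs.span_sum vs.span_scale vs.span_base) auto
    finally show "p \<in> vs.span ?T" .
  qed
  ultimately obtain c where c: "\<exists>x\<in>?I. c x \<noteq> 0" "(\<Sum>x\<in>?I. smult [:c x:] (?v x)) = 0"
    using vs.dependent_family[of ?I ?T ?v] by auto
  have "(\<Sum>i<N. (\<Sum>j<N. (\<Sum>l<N. [:[:c (i, j, l):]:] * f3 ^ l) * f2 ^ j) * f1 ^ i)
      = (\<Sum>x\<in>?I. smult [:c x:] (?v x))"
    by (simp add: sum_distrib_left sum_distrib_right sum.cartesian_product case_prod_unfold mult_ac)
  then show thesis
    using c by (intro that[where N = N and c = "\<lambda>i j l. c (i, j, l)"]) auto
qed

text \<open>The sum is \<open>f^m\<close> times \<open>g m + f * (\<dots>)\<close>. As \<open>P\<close> is prime and \<open>f \<notin> P\<close>, the second factor lies in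
\<open>P \<subseteq> Q\<close>, and \<open>f \<in> Q\<close> leaves \<open>g m \<in> Q\<close>.\<close>

lemma (in domain_subring) lowest_coefficient_in_larger_ideal:
  assumes P: "prime_in P" and Q: "ideal_in Q" "P \<subseteq> Q" and f: "f \<in> Q" "f \<notin> P"
    and "(\<Sum>i<n. g i * f ^ i) \<in> P" "\<forall>i<n. g i \<in> B" "m < n" "\<forall>i<m. g i = 0"
  shows "g m \<in> Q"
  using assms(6-)
proof (induction m arbitrary: n g)
  case (0 n g)
  then obtain n' where n: "n = Suc n'" by (cases n) auto
  have fB: "f \<in> B" using f Q by (auto simp: ideal_in_def)
  let ?r = "\<Sum>i<n'. g (Suc i) * f ^ i"
  have eq: "(\<Sum>i<n. g i * f ^ i) = g 0 + ?r * f"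
    unfolding n sum.lessThan_Suc_shift sum_distrib_right by (simp add: mult_ac)
  have "?r * f \<in> Q"
    using Q f fB 0(2) unfolding n ideal_in_def by (auto intro!: closed)
  moreover have "g 0 + ?r * f \<in> Q"
    using 0(1) Q(2) eq by auto
  ultimately have "g 0 + ?r * f - ?r * f \<in> Q"
    using ideal_in_diff[OF Q(1)] by blast
  then show ?case by simp
next
  case (Suc m n g)
  then obtain n' where n: "n = Suc n'" by (cases n) auto
  have fB: "f \<in> B" using f Q by (auto simp: ideal_in_def)
  let ?r = "\<Sum>i<n'. g (Suc i) * f ^ i"
  have "(\<Sum>i<n. g i * f ^ i) = ?r * f"
    using Suc.prems(4) unfolding n sum.lessThan_Suc_shift sum_distrib_right by (simp add: mult_ac)
  then have "?r * f \<in> P" using Suc.prems(1) by simp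
  moreover have "?r \<in> B"
    using Suc.prems(2) fB unfolding n by (auto intro!: closed)
  ultimately have "?r \<in> P"
    using P f fB unfolding prime_in_def by blast
  then show ?case
    using Suc.IH[of "\<lambda>i. g (Suc i)" n'] Suc.prems n by auto
qed

context cone_over_normal_curve
begin

lemma proper_chain_numerator:
  assumes "L.prime_in P" "L.prime_in Q" "P \<subset> Q"
  obtains p where "p \<in> V" "to_fract p \<in> Q" "to_fract p \<notin> P"
proof -
  have ideals: "L.ideal_in P" "L.ideal_in Q"
    using assms by (auto simp: L.prime_in_def)
  obtain x where x: "x \<in> Q" "x \<notin> P" using assms by blast
  moreover obtain p q where "p \<in> V" "q \<in> D" "x = to_fract p / to_fract q"
    using x ideals LE unfolding L.ideal_in_def by (metis subsetD)
  ultimately show thesis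
    using that numerator_mem_iff ideals by blast
qed

text \<open>The relation between \<open>f1\<close>, \<open>f2\<close>, \<open>f3\<close> is read as a polynomial in \<open>f1\<close> over polynomials in \<open>f2\<close> over
polynomials in \<open>f3\<close>. Each step of the chain passes to the lowest nonvanishing coefficient; after three
steps it is a nonzero constant lying in \<open>P3\<close>.\<close>

theorem L_no_long_prime_chain:
  assumes P: "L.prime_in P0" "L.prime_in P1" "L.prime_in P2" "L.prime_in P3"
    and chain: "P0 \<subset> P1" "P1 \<subset> P2" "P2 \<subset> P3"
  shows False
proof -
  obtain f1 where f1: "f1 \<in> V" "to_fract f1 \<in> P1" "to_fract f1 \<notin> P0"
    using proper_chain_numerator[OF P(1,2) chain(1)] .
  obtain f2 where f2: "f2 \<in> V" "to_fract f2 \<in> P2" "to_fract f2 \<notin> P1"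
    using proper_chain_numerator[OF P(2,3) chain(2)] .
  obtain f3 where f3: "f3 \<in> V" "to_fract f3 \<in> P3" "to_fract f3 \<notin> P2"
    using proper_chain_numerator[OF P(3,4) chain(3)] .
  obtain N c where rel: "(\<Sum>i<N. (\<Sum>j<N. (\<Sum>l<N. [:[:c i j l:]:] * f3 ^ l) * f2 ^ j) * f1 ^ i) = 0"
    and nz: "\<exists>i<N. \<exists>j<N. \<exists>l<N. c i j l \<noteq> (0::'k)"
    by (rule algebraically_dependent_three)
  let ?c = "\<lambda>i j l. to_fract [:[:c i j l:]:]"
  let ?g2 = "\<lambda>i j. \<Sum>l<N. ?c i j l * to_fract f3 ^ l"
  let ?g1 = "\<lambda>i. \<Sum>j<N. ?g2 i j * to_fract f2 ^ j"
  have const: "?c i j l \<in> L" for i j l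
    by (intro to_fract_in_L) (simp add: V_def coeff_pCons split: nat.split)
  have inL: "to_fract f1 \<in> L" "to_fract f2 \<in> L" "to_fract f3 \<in> L"
    using f1 f2 f3 to_fract_in_L by auto
  have g2: "?g2 i j \<in> L" for i j
    by (rule L.sum_closed) (rule L.mult_closed[OF const L.power_closed[OF inL(3)]])
  have g1: "?g1 i \<in> L" for i
    by (rule L.sum_closed) (rule L.mult_closed[OF g2 L.power_closed[OF inL(2)]])
  have sum_eq: "(\<Sum>i<N. ?g1 i * to_fract f1 ^ i)
      = to_fract (\<Sum>i<N. (\<Sum>j<N. (\<Sum>l<N. [:[:c i j l:]:] * f3 ^ l) * f2 ^ j) * f1 ^ i)"
    by (simp only: to_fract_sum to_fract_mult to_fract_power)
  have sum0: "(\<Sum>i<N. ?g1 i * to_fract f1 ^ i) \<in> P0"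
    unfolding sum_eq rel to_fract_0 using P(1) by (simp add: L.prime_in_def L.ideal_in_def)
  have ideals: "L.ideal_in P1" "L.ideal_in P2" "L.ideal_in P3"
    using P by (auto simp: L.prime_in_def)
  define i0 where "i0 = (LEAST i. i < N \<and> (\<exists>j<N. \<exists>l<N. c i j l \<noteq> 0))"
  have i0: "i0 < N \<and> (\<exists>j<N. \<exists>l<N. c i0 j l \<noteq> 0)"
    unfolding i0_def by (rule LeastI_ex) (use nz in blast)
  have i0_min: "c i j l = 0" if "i < i0" "j < N" "l < N" for i j l
    using not_less_Least[OF that(1)[unfolded i0_def]] that i0 by auto
  define j0 where "j0 = (LEAST j. j < N \<and> (\<exists>l<N. c i0 j l \<noteq> 0))"
  have j0: "j0 < N \<and> (\<exists>l<N. c i0 j0 l \<noteq> 0)"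
    unfolding j0_def by (rule LeastI_ex) (use i0 in blast)
  have j0_min: "c i0 j l = 0" if "j < j0" "l < N" for j l
    using not_less_Least[OF that(1)[unfolded j0_def]] that j0 by auto
  define l0 where "l0 = (LEAST l. l < N \<and> c i0 j0 l \<noteq> 0)"
  have l0: "l0 < N \<and> c i0 j0 l0 \<noteq> 0"
    unfolding l0_def by (rule LeastI_ex) (use j0 in blast)
  have l0_min: "c i0 j0 l = 0" if "l < l0" for l
    using not_less_Least[OF that(1)[unfolded l0_def]] that l0 by auto
  have "?g1 i0 \<in> P1"
    using i0 g1 i0_min chain
    by (intro L.lowest_coefficient_in_larger_ideal[OF P(1) ideals(1) _ f1(2,3) sum0]) auto
  then have "?g2 i0 j0 \<in> P2"
    using j0 g2 j0_min chain
    by (intro L.lowest_coefficient_in_larger_ideal[OF P(2) ideals(2) _ f2(2,3)]) auto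
  then have "?c i0 j0 l0 \<in> P3"
    using l0 const l0_min chain
    by (intro L.lowest_coefficient_in_larger_ideal[OF P(3) ideals(3) _ f3(2,3), where n = N]) auto
  moreover have "to_fract [:[:inverse (c i0 j0 l0):]:] \<in> L"
    by (intro to_fract_in_L) (simp add: V_def coeff_pCons split: nat.split)
  ultimately have "to_fract [:[:inverse (c i0 j0 l0):]:] * ?c i0 j0 l0 \<in> P3"
    using ideals(3) unfolding L.ideal_in_def by blast
  then have "1 \<in> P3"
    using l0 by (simp flip: to_fract_mult one_pCons)
  then have "P3 = L"
    using ideals(3) unfolding L.ideal_in_def by (metis mult.right_neutral subsetI subset_antisym)
  then show False using P(4) by (simp add: L.prime_in_def)
qed

end

section \<open>Record rings modelled in a field\<close>

text \<open>An isomorphism from a subring of a domain onto a ring given as a record. Through it, ideals, prime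
ideals, regular sequences and socles of the record are images of their counterparts in the domain.\<close>

locale ring_model = domain_subring B for B :: "'f::idom set" +
  fixes A :: "('a, 'b) ring_scheme" (structure) and g :: "'f \<Rightarrow> 'a"
  assumes carrier_eq: "carrier A = g ` B"
    and inj: "inj_on g B"
    and g_mult: "x \<in> B \<Longrightarrow> y \<in> B \<Longrightarrow> g x \<otimes> g y = g (x * y)"
    and g_add: "x \<in> B \<Longrightarrow> y \<in> B \<Longrightarrow> g x \<oplus> g y = g (x + y)"
    and g_one: "\<one> = g 1"
    and g_zero: "\<zero> = g 0"
begin

lemma g_closed: "x \<in> B \<Longrightarrow> g x \<in> carrier A"
  by (simp add: carrier_eq)

lemma cring_model: "cring A"
proof (rule cringI)
  show "abelian_group A"
  proof (rule abelian_groupI)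
    fix x assume "x \<in> carrier A"
    then obtain x' where "x' \<in> B" "x = g x'" by (auto simp: carrier_eq)
    then show "\<exists>y\<in>carrier A. y \<oplus> x = \<zero>"
      by (intro bexI[of _ "g (- x')"]) (auto simp: g_add g_zero carrier_eq closed)
  qed (auto simp: carrier_eq g_add g_zero closed ac_simps)
  show "comm_monoid A"
    by (rule comm_monoidI) (auto simp: carrier_eq g_mult g_one closed ac_simps)
qed (auto simp: carrier_eq g_mult g_add closed algebra_simps)

sublocale cring A
  by (rule cring_model)

lemma g_eq_iff: "x \<in> B \<Longrightarrow> y \<in> B \<Longrightarrow> g x = g y \<longleftrightarrow> x = y"
  using inj by (auto simp: inj_on_def)

lemma g_mem_image_iff: "x \<in> B \<Longrightarrow> I \<subseteq> B \<Longrightarrow> g x \<in> g ` I \<longleftrightarrow> x \<in> I"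
  using inj by (auto simp: inj_on_def)

lemma image_subset_iff_subset:
  assumes "I \<subseteq> B" "J \<subseteq> B"
  shows "g ` I \<subseteq> g ` J \<longleftrightarrow> I \<subseteq> J"
proof
  assume *: "g ` I \<subseteq> g ` J"
  show "I \<subseteq> J"
  proof
    fix x assume "x \<in> I"
    with * assms show "x \<in> J"
      using g_mem_image_iff[of x J] by blast
  qed
qed auto

lemma g_uminus: "x \<in> B \<Longrightarrow> \<ominus> g x = g (- x)"
  by (rule minus_equality) (auto simp: g_add g_zero closed g_closed)

lemma g_diff: "x \<in> B \<Longrightarrow> y \<in> B \<Longrightarrow> g x \<ominus> g y = g (x - y)"
  by (simp add: a_minus_def g_uminus g_add closed)

lemma g_sum: "finite I \<Longrightarrow> (\<And>i. i \<in> I \<Longrightarrow> f i \<in> B) \<Longrightarrow> (\<Oplus>i\<in>I. g (f i)) = g (sum f I)"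
  by (induction I rule: finite_induct)
    (auto simp: g_zero finsum_insert Pi_def g_closed g_add closed)

lemma ideal_image:
  assumes "ideal_in I"
  shows "ideal (g ` I) A"
proof (rule idealI)
  have sub: "I \<subseteq> B" using assms by (simp add: ideal_in_def)
  show "subgroup (g ` I) (add_monoid A)"
  proof (rule add.subgroupI)
    show "g ` I \<subseteq> carrier A" using sub by (auto simp: carrier_eq)
    show "g ` I \<noteq> {}" using assms by (auto simp: ideal_in_def)
    show "\<ominus> a \<in> g ` I" if "a \<in> g ` I" for a
      using that sub ideal_in_uminus[OF assms] by (auto simp: g_uminus subset_iff)
    show "a \<oplus> b \<in> g ` I" if "a \<in> g ` I" "b \<in> g ` I" for a b
      using that sub assms by (auto simp: g_add subset_iff ideal_in_def)
  qed
  show *: "x \<otimes> a \<in> g ` I" if "a \<in> g ` I" "x \<in> carrier A" for a x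
    using that sub assms by (auto simp: g_mult subset_iff ideal_in_def carrier_eq)
  show "a \<otimes> x \<in> g ` I" if "a \<in> g ` I" "x \<in> carrier A" for a x
    using *[OF that] that sub by (subst m_comm) (auto simp: carrier_eq)
qed (rule ring_axioms)

lemma ideal_preimage:
  assumes "ideal J A"
  obtains I where "ideal_in I" "J = g ` I"
proof
  interpret J: ideal J A by fact
  let ?I = "{x \<in> B. g x \<in> J}"
  show "J = g ` ?I"
    using J.a_subset by (auto simp: carrier_eq)
  show "ideal_in ?I"
    unfolding ideal_in_def
  proof (intro conjI ballI)
    show "0 \<in> ?I" using J.zero_closed by (simp add: closed g_zero)
    show "x + y \<in> ?I" if "x \<in> ?I" "y \<in> ?I" for x y
      using that J.a_closed[of "g x" "g y"] by (auto simp: closed g_add)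
    show "r * x \<in> ?I" if "r \<in> B" "x \<in> ?I" for r x
      using that J.I_l_closed[of "g x" "g r"] by (auto simp: closed g_mult g_closed)
  qed auto
qed

lemma primeideal_image:
  assumes "prime_in P"
  shows "primeideal (g ` P) A"
proof (rule primeidealI)
  have sub: "P \<subseteq> B" using assms by (simp add: prime_in_def ideal_in_def)
  show "ideal (g ` P) A" using assms by (auto simp: prime_in_def intro: ideal_image)
  show "cring A" by (rule is_cring)
  show "carrier A \<noteq> g ` P"
    unfolding carrier_eq using assms sub image_subset_iff_subset[of B P] by (auto simp: prime_in_def)
  show "a \<in> g ` P \<or> b \<in> g ` P" if ab: "a \<in> carrier A" "b \<in> carrier A" "a \<otimes> b \<in> g ` P" for a b
  proof -
    obtain x y where xy: "x \<in> B" "y \<in> B" "a = g x" "b = g y"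
      using ab by (auto simp: carrier_eq)
    then have "x * y \<in> P"
      using ab(3) g_mem_image_iff[OF mult_closed[OF xy(1,2)] sub] by (simp add: g_mult)
    then have "x \<in> P \<or> y \<in> P"
      using assms xy by (simp add: prime_in_def)
    then show ?thesis using xy by blast
  qed
qed

lemma primeideal_preimage:
  assumes "primeideal J A"
  obtains P where "prime_in P" "J = g ` P"
proof -
  interpret J: primeideal J A by fact
  obtain P where P: "ideal_in P" "J = g ` P"
    using ideal_preimage[OF J.is_ideal] .
  have sub: "P \<subseteq> B" using P by (simp add: ideal_in_def)
  have "prime_in P"
    unfolding prime_in_def
  proof (intro conjI ballI impI P(1))
    show "P \<noteq> B" using J.I_notcarr P carrier_eq by blast
    fix x y assume "x \<in> B" "y \<in> B" "x * y \<in> P"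
    then show "x \<in> P \<or> y \<in> P"
      using J.I_prime[of "g x" "g y"] g_closed
      unfolding P by (auto simp: g_mult g_mem_image_iff sub)
  qed
  then show thesis using that P by blast
qed

lemma genideal_image:
  assumes "ideal_in I" "X \<subseteq> I" "\<And>J. ideal_in J \<Longrightarrow> X \<subseteq> J \<Longrightarrow> I \<subseteq> J"
  shows "genideal A (g ` X) = g ` I"
proof
  show "genideal A (g ` X) \<subseteq> g ` I"
    using ideal_image assms by (intro genideal_minimal) auto
  have X: "g ` X \<subseteq> carrier A"
    using assms(1,2) by (auto simp: ideal_in_def carrier_eq)
  obtain J where J: "ideal_in J" "genideal A (g ` X) = g ` J"
    using ideal_preimage[OF genideal_ideal[OF X]] .
  then have "g ` X \<subseteq> g ` J"
    using genideal_self[OF X] by simp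
  then have "X \<subseteq> J"
    using assms(1,2) J(1) image_subset_iff_subset by (simp add: ideal_in_def subset_iff)
  then show "g ` I \<subseteq> genideal A (g ` X)"
    unfolding J(2) using assms(3) J(1) by blast
qed

lemma genideal_empty_model: "genideal A {} = g ` {0}"
  using genideal_image[of "{0}" "{}"] by (auto simp: ideal_in_def closed)

lemma genideal_single_model:
  assumes "x \<in> B"
  shows "genideal A {g x} = g ` ((*) x ` B)"
proof -
  have "ideal_in ((*) x ` B)"
    unfolding ideal_in_def
  proof (intro conjI ballI)
    show "(*) x ` B \<subseteq> B" using assms by (auto intro: closed)
    show "0 \<in> (*) x ` B" by (rule image_eqI[of _ _ 0]) (auto intro: closed)
    fix y z assume "y \<in> (*) x ` B" "z \<in> (*) x ` B"
    then show "y + z \<in> (*) x ` B"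
      by (auto simp flip: distrib_left intro!: imageI closed)
  next
    fix r y assume "r \<in> B" "y \<in> (*) x ` B"
    then show "r * y \<in> (*) x ` B"
      by (auto simp: mult.left_commute[of r] intro!: imageI closed)
  qed
  moreover have "{x} \<subseteq> (*) x ` B"
    by (auto intro!: image_eqI[of _ _ 1] closed)
  moreover have "(*) x ` B \<subseteq> J" if "ideal_in J" "{x} \<subseteq> J" for J
    using that by (auto simp: ideal_in_def mult.commute[of x])
  ultimately show ?thesis
    using genideal_image[of "(*) x ` B" "{x}"] by simp
qed

lemma genideal_pair_model:
  assumes "x \<in> B" "y \<in> B"
  shows "genideal A {g x, g y} = g ` ideal2 x y"
proof -
  have "x \<in> ideal2 x y" "y \<in> ideal2 x y"
    by (auto intro: ideal2I[of 1 0] ideal2I[of 0 1] closed)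
  moreover have "ideal2 x y \<subseteq> J" if "ideal_in J" "{x, y} \<subseteq> J" for J
  proof
    fix z assume "z \<in> ideal2 x y"
    then obtain p q where "p \<in> B" "q \<in> B" "z = p * x + q * y"
      by (auto simp: mult.commute elim!: ideal2E)
    then show "z \<in> J"
      using that by (auto simp: ideal_in_def)
  qed
  ultimately show ?thesis
    using genideal_image[OF ideal_in_ideal2[OF assms], of "{x, y}"] by simp
qed

lemma noetherian_model:
  assumes "\<And>I. ideal_in I \<Longrightarrow> \<exists>X\<subseteq>I. finite X \<and> (\<forall>J. ideal_in J \<longrightarrow> X \<subseteq> J \<longrightarrow> I \<subseteq> J)"
  shows "noetherian_ring A"
proof (rule noetherian_ringI)
  fix J assume "ideal J A"
  then obtain I where I: "ideal_in I" "J = g ` I" by (rule ideal_preimage)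
  then obtain X where X: "X \<subseteq> I" "finite X" "\<And>J. ideal_in J \<Longrightarrow> X \<subseteq> J \<Longrightarrow> I \<subseteq> J"
    using assms[OF I(1)] by blast
  then have "genideal A (g ` X) = J"
    using genideal_image[OF I(1)] I(2) by blast
  moreover have "g ` X \<subseteq> carrier A"
    using X I by (auto simp: ideal_in_def carrier_eq)
  ultimately show "\<exists>X\<subseteq>carrier A. finite X \<and> J = genideal A X"
    using X(2) by (metis finite_imageI)
qed

text \<open>An ideal containing an element outside \<open>M\<close>, hence a unit, is the whole ring.\<close>

lemma maximalideal_model_iff:
  assumes M: "ideal_in M" "1 \<notin> M" "\<And>x. x \<in> B \<Longrightarrow> x \<notin> M \<Longrightarrow> \<exists>y\<in>B. x * y = 1"
  shows "maximalideal J A \<longleftrightarrow> J = g ` M"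
proof -
  have M_sub: "M \<subseteq> B" using M by (simp add: ideal_in_def)
  have below: "J \<subseteq> g ` M" if J: "ideal J A" "J \<noteq> carrier A" for J
  proof -
    obtain I where I: "ideal_in I" "J = g ` I" using ideal_preimage[OF J(1)] .
    have "I \<subseteq> M"
    proof
      fix x assume x: "x \<in> I"
      show "x \<in> M"
      proof (rule ccontr)
        assume "x \<notin> M"
        moreover have "x \<in> B" using x I by (auto simp: ideal_in_def)
        ultimately obtain y where "y \<in> B" "x * y = 1"
          using M(3) by blast
        then have "y * x \<in> I"
          using x I by (simp add: ideal_in_def)
        then have "1 \<in> I"
          using \<open>x * y = 1\<close> by (simp add: mult.commute)
        then have "r * 1 \<in> I" if "r \<in> B" for r
          using that I by (simp only: ideal_in_def)
        then have "B \<subseteq> I" by auto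
        then show False using I J(2) carrier_eq by (auto simp: ideal_in_def)
      qed
    qed
    then show ?thesis using I by blast
  qed
  have proper: "g ` M \<noteq> carrier A"
    using M(2) M_sub g_mem_image_iff[of 1 M] closed by (auto simp: carrier_eq)
  show ?thesis
  proof
    assume "maximalideal J A"
    then interpret J: maximalideal J A .
    have "J \<subseteq> g ` M" using below J.is_ideal J.I_notcarr by auto
    then show "J = g ` M"
      using J.I_maximal[OF ideal_image[OF M(1)]] M_sub proper by (auto simp: carrier_eq)
  next
    assume "J = g ` M"
    then show "maximalideal J A"
      using proper below ideal_image[OF M(1)] by (auto intro!: maximalidealI)
  qed
qed

text \<open>The map \<open>h\<close> sends an element of \<open>B\<close> to its coset. It turns the quotient ring into \<open>B\<close> modulo \<open>I\<close>, so that
statements on cosets become statements on representatives.\<close>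

lemma socle_basis_model:
  assumes I: "ideal_in I" and M: "M \<subseteq> B" "the_max_ideal A = g ` M"
    and b: "socle_basis_in M I n b"
  shows "socle_basis A (g ` I) n (\<lambda>i. g ` I +>\<^bsub>A\<^esub> g (b i))"
proof -
  interpret J: ideal "g ` I" A by (rule ideal_image[OF I])
  interpret Q: cring "A Quot (g ` I)" by (rule J.quotient_is_cring[OF is_cring])
  interpret q: ring_hom_cring A "A Quot (g ` I)" "(+>) (g ` I)"
    by (rule J.rcos_ring_hom_cring[OF is_cring])
  have I_sub: "I \<subseteq> B" using I by (simp add: ideal_in_def)
  define h where "h x = g ` I +> g x" for x
  have h_carrier: "carrier (A Quot (g ` I)) = h ` B"
  proof -
    have "carrier (A Quot (g ` I)) = (\<Union>a\<in>carrier A. {g ` I +> a})"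
      unfolding FactRing_def A_RCOSETS_def' partial_object.simps by (rule refl)
    then show ?thesis
      unfolding carrier_eq h_def by blast
  qed
  have h_eq_iff: "h x = h y \<longleftrightarrow> x - y \<in> I" if "x \<in> B" "y \<in> B" for x y
    using that quotient_eq_iff_same_a_r_cos[OF J.is_ideal, of "g x" "g y"] I_sub
    by (simp add: h_def g_closed g_diff g_mem_image_iff closed)
  have h_zero: "\<zero>\<^bsub>A Quot (g ` I)\<^esub> = h 0"
    using q.hom_zero by (simp add: h_def g_zero)
  have h_mult: "h x \<otimes>\<^bsub>A Quot (g ` I)\<^esub> h y = h (x * y)" if "x \<in> B" "y \<in> B" for x y
    using that q.hom_mult[of "g x" "g y"] by (simp add: h_def g_closed g_mult)
  have h_sum: "(\<Oplus>\<^bsub>A Quot (g ` I)\<^esub>i\<in>{..<n}. h (f i)) = h (\<Sum>i<n. f i)"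
    if "\<And>i. i < n \<Longrightarrow> f i \<in> B" for f
  proof -
    have "h (\<Sum>i<n. f i) = g ` I +> (\<Oplus>i\<in>{..<n}. g (f i))"
      using g_sum[of "{..<n}" f] that by (simp add: h_def)
    also have "\<dots> = (\<Oplus>\<^bsub>A Quot (g ` I)\<^esub>i\<in>{..<n}. ((+>) (g ` I) \<circ> (\<lambda>i. g (f i))) i)"
      by (rule q.hom_finsum) (use that g_closed in auto)
    finally show ?thesis by (simp add: h_def)
  qed
  have comb: "(\<Oplus>\<^bsub>A Quot (g ` I)\<^esub>i\<in>{..<n}. (g ` I +> c i) \<otimes>\<^bsub>A Quot (g ` I)\<^esub> h (b i))
      = h (\<Sum>i<n. c' i * b i)" if "\<And>i. i < n \<Longrightarrow> c i = g (c' i)" "\<And>i. i < n \<Longrightarrow> c' i \<in> B" for c c'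
  proof -
    have bB: "b i \<in> B" if "i < n" for i
      using b that by (simp add: socle_basis_in_def)
    have "(\<Oplus>\<^bsub>A Quot (g ` I)\<^esub>i\<in>{..<n}. (g ` I +> c i) \<otimes>\<^bsub>A Quot (g ` I)\<^esub> h (b i))
        = (\<Oplus>\<^bsub>A Quot (g ` I)\<^esub>i\<in>{..<n}. h (c' i * b i))"
      using that bB
      by (intro Q.finsum_cong') (auto simp: h_mult closed h_carrier simp flip: h_def)
    then show ?thesis using h_sum that bB closed by simp
  qed
  have socle_iff: "h z \<in> socle_Quot A (g ` I) \<longleftrightarrow> (\<forall>r\<in>M. r * z \<in> I)" if "z \<in> B" for z
    using that M I_sub h_eq_iff
    by (auto simp: socle_Quot_def h_carrier h_zero h_mult closed subset_iff simp flip: h_def)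
  have "socle_basis A (g ` I) n (\<lambda>i. h (b i))"
    unfolding socle_basis_def
  proof (intro conjI ballI impI allI)
    show "(\<lambda>i. h (b i)) \<in> {..<n} \<rightarrow> socle_Quot A (g ` I)"
      using b socle_iff by (auto simp: socle_basis_in_def)
  next
    fix z assume z: "z \<in> socle_Quot A (g ` I)"
    then obtain z' where z': "z' \<in> B" "z = h z'"
      by (auto simp: socle_Quot_def h_carrier)
    then obtain c where c: "\<forall>i<n. c i \<in> B" "z' - (\<Sum>i<n. c i * b i) \<in> I"
      using b z socle_iff unfolding socle_basis_in_def by blast
    have "z = h (\<Sum>i<n. c i * b i)"
      unfolding z'(2) using c z' b
      by (subst h_eq_iff) (auto intro!: closed simp: socle_basis_in_def)
    also have "\<dots> = (\<Oplus>\<^bsub>A Quot (g ` I)\<^esub>i\<in>{..<n}. (g ` I +> g (c i)) \<otimes>\<^bsub>A Quot (g ` I)\<^esub> h (b i))"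
      using comb[of "\<lambda>i. g (c i)" c] c by simp
    finally show "\<exists>c\<in>{..<n} \<rightarrow> carrier A.
        z = (\<Oplus>\<^bsub>A Quot (g ` I)\<^esub>i\<in>{..<n}. (g ` I +> c i) \<otimes>\<^bsub>A Quot (g ` I)\<^esub> h (b i))"
      using c by (intro bexI[of _ "\<lambda>i. g (c i)"]) (auto simp: g_closed)
  next
    fix c i assume c: "c \<in> {..<n} \<rightarrow> carrier A" and i: "i < n"
      and zero: "(\<Oplus>\<^bsub>A Quot (g ` I)\<^esub>i\<in>{..<n}. (g ` I +> c i) \<otimes>\<^bsub>A Quot (g ` I)\<^esub> h (b i))
        = \<zero>\<^bsub>A Quot (g ` I)\<^esub>"
    have "\<forall>i. \<exists>c'. i < n \<longrightarrow> c i = g c' \<and> c' \<in> B"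
      using c by (force simp: carrier_eq)
    then obtain c' where c': "\<And>i. i < n \<Longrightarrow> c i = g (c' i)" "\<And>i. i < n \<Longrightarrow> c' i \<in> B"
      by metis
    have "h (\<Sum>i<n. c' i * b i) = h 0"
      using zero comb[OF c'] h_zero by simp
    moreover have "(\<Sum>i<n. c' i * b i) \<in> B"
      using c' b by (auto intro!: closed simp: socle_basis_in_def)
    ultimately have "(\<Sum>i<n. c' i * b i) \<in> I"
      using h_eq_iff closed by fastforce
    then have "c' i \<in> M" using b c' i unfolding socle_basis_in_def by blast
    then show "c i \<in> the_max_ideal A" using M c' i by blast
  qed
  then show ?thesis by (simp add: h_def)
qed

lemma regular_sequence_modelD:
  assumes reg: "regular_sequence A xs" and len: "2 \<le> length xs"
    and xy: "x \<in> B" "y \<in> B" "xs ! 0 = g x" "xs ! 1 = g y"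
  shows "x \<noteq> 0" "regular_mod x y"
proof -
  have step: "z' \<in> genideal A (set (take i xs))"
    if "i < 2" "z' \<in> carrier A" "xs ! i \<otimes> z' \<in> genideal A (set (take i xs))" for i z'
    using reg that len unfolding regular_sequence_def by (meson less_le_trans)
  have take1: "set (take 1 xs) = {g x}"
    using len xy by (cases xs) auto
  show "x \<noteq> 0"
  proof
    assume "x = 0"
    then have "g 1 \<in> genideal A (set (take 0 xs))"
      using step[of 0 "g 1"] xy g_closed
      by (simp add: genideal_empty_model g_mult closed)
    then show False
      using g_eq_iff[of 1 0] by (simp add: genideal_empty_model closed)
  qed
  show "regular_mod x y"
    unfolding regular_mod_def
  proof (intro ballI impI)
    fix f f' assume f: "f \<in> B" "f' \<in> B" "y * f = x * f'"
    have sub: "(*) x ` B \<subseteq> B" using xy by (auto intro: closed)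
    have "xs ! 1 \<otimes> g f = g (x * f')"
      using f xy by (simp add: g_mult)
    then have "xs ! 1 \<otimes> g f \<in> genideal A (set (take 1 xs))"
      unfolding take1 using f xy by (auto simp: genideal_single_model)
    then have "g f \<in> genideal A (set (take 1 xs))"
      using step g_closed[OF f(1)] by simp
    then have "f \<in> (*) x ` B"
      unfolding take1 genideal_single_model[OF xy(1)] g_mem_image_iff[OF f(1) sub] .
    then show "\<exists>h\<in>B. f = x * h" by blast
  qed
qed

lemma regular_sequence_pairI:
  assumes xy: "x \<in> B" "y \<in> B" "x \<noteq> 0" "regular_mod x y" "1 \<notin> ideal2 x y"
  shows "regular_sequence A [g x, g y]"
  unfolding regular_sequence_def
proof (intro conjI allI impI ballI)
  show "set [g x, g y] \<subseteq> carrier A" using xy by (simp add: g_closed)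
  have sub: "ideal2 x y \<subseteq> B" "(*) x ` B \<subseteq> B"
    using ideal_in_ideal2[OF xy(1,2)] xy by (auto simp: ideal_in_def intro: closed)
  have "g 1 \<notin> g ` ideal2 x y"
    using xy(5) sub g_mem_image_iff closed by blast
  then show "genideal A (set [g x, g y]) \<noteq> carrier A"
    using xy genideal_pair_model g_closed[of 1] closed(2) by auto
  fix i z assume i: "i < length [g x, g y]" and z: "z \<in> carrier A"
    and prod: "[g x, g y] ! i \<otimes> z \<in> genideal A (set (take i [g x, g y]))"
  obtain f where f: "f \<in> B" "z = g f" using z by (auto simp: carrier_eq)
  consider "i = 0" | "i = 1" using i by (auto simp: less_Suc_eq)
  then show "z \<in> genideal A (set (take i [g x, g y]))"
  proof cases
    case 1
    then have "x * f = 0"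
      using prod f xy g_eq_iff[of "x * f" 0] by (simp add: genideal_empty_model g_mult closed)
    then show ?thesis using 1 f xy by (simp add: genideal_empty_model)
  next
    case 2
    then have "g (y * f) \<in> g ` ((*) x ` B)"
      using prod f xy by (simp add: genideal_single_model g_mult)
    then have "y * f \<in> (*) x ` B"
      unfolding g_mem_image_iff[OF mult_closed[OF xy(2) f(1)] sub(2)] .
    then obtain f' where "f' \<in> B" "y * f = x * f'" by blast
    then have "f \<in> (*) x ` B" using regular_modD[OF xy(4) f(1)] by blast
    then show ?thesis using 2 f xy by (simp add: genideal_single_model)
  qed
qed

end

context cone_over_normal_curve
begin

lemma ideal2_params_proper: "x \<in> M \<Longrightarrow> y \<in> M \<Longrightarrow> 1 \<notin> L.ideal2 x y"
proof
  assume xy: "x \<in> M" "y \<in> M" "1 \<in> L.ideal2 x y"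
  then obtain p q where "p \<in> L" "q \<in> L" "1 = p * x + q * y"
    by (metis L.ideal2E mult.commute)
  then have "1 \<in> M" using M_ideal xy unfolding L.ideal_in_def by metis
  then show False using one_notin_M by simp
qed

text \<open>Depth at most two follows from the socle: a third element of a regular sequence would annihilate the
nonzero class of \<open>b 0\<close> modulo the first two.\<close>

theorem has_cohen_macaulay_type_model:
  fixes A :: "('a, 'b) ring_scheme"
  assumes "ring_model L A g"
  shows "has_cohen_macaulay_type A (k - 1)"
proof -
  interpret ring_model L A g by fact
  let ?u = "to_fract u" and ?v = "to_fract v"
  have max_iff: "maximalideal J A \<longleftrightarrow> J = g ` M" for J
  proof (rule maximalideal_model_iff[OF M_ideal one_notin_M])
    fix x assume x: "x \<in> L" "x \<notin> M"
    then have "x \<noteq> 0" using M_ideal by (auto simp: L.ideal_in_def)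
    then show "\<exists>y\<in>L. x * y = 1"
      using unit_in_L[OF x] by (intro bexI[of _ "inverse x"]) auto
  qed
  then have max: "the_max_ideal A = g ` M"
    by (simp add: the_max_ideal_def)
  have local: "noetherian_local_ring A"
    using is_cring noetherian_model[OF L_noetherian] max_iff by (auto simp: noetherian_local_ring_def)
  have uvL: "?u \<in> L" "?v \<in> L" using params_in_M M_subset by auto
  have nz: "?v \<noteq> 0" "?u \<noteq> 0" using v_nonzero u_nonzero by auto

  have dim: "krull_dim A = 2"
  proof (rule antisym)
    show "krull_dim A \<le> 2"
      unfolding krull_dim_def
    proof (rule Sup_least, safe)
      fix n P assume P: "\<forall>i\<le>n. primeideal (P i) A" "\<forall>i<n. P i \<subset> P (Suc i)"
      show "enat n \<le> 2"
      proof (rule ccontr)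
        assume "\<not> enat n \<le> 2"
        then have n: "3 \<le> n" by (simp add: numeral_eq_enat)
        then have "primeideal (P 0) A" "primeideal (P 1) A" "primeideal (P 2) A" "primeideal (P 3) A"
          using P(1) by auto
        then obtain P0 P1 P2 P3 where
          Q: "L.prime_in P0" "L.prime_in P1" "L.prime_in P2" "L.prime_in P3"
            "P 0 = g ` P0" "P 1 = g ` P1" "P 2 = g ` P2" "P 3 = g ` P3"
          by (metis primeideal_preimage)
        have "P 0 \<subset> P 1" "P 1 \<subset> P 2" "P 2 \<subset> P 3"
          using P(2) n by (auto simp: numeral_eq_Suc)
        then have "P0 \<subset> P1" "P1 \<subset> P2" "P2 \<subset> P3"
          unfolding Q(5-8) using Q(1-4) image_subset_iff_subset
          by (auto simp: psubset_eq L.prime_in_def L.ideal_in_def)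
        then show False using L_no_long_prime_chain Q(1-4) by blast
      qed
    qed
    have zero_prime: "L.prime_in {0}"
      unfolding L.prime_in_def L.ideal_in_def using L.closed one_notin_M
      by (auto simp: set_eq_iff intro: exI[of _ 1])
    have M_prime: "L.prime_in M"
      unfolding L.prime_in_def
    proof (intro conjI ballI impI M_ideal)
      show "M \<noteq> L" using one_notin_M L.closed by blast
      fix x y assume xy: "x \<in> L" "y \<in> L" "x * y \<in> M"
      show "x \<in> M \<or> y \<in> M"
      proof (cases "x \<in> M")
        case False
        then have "x \<noteq> 0" using M_ideal by (auto simp: L.ideal_in_def)
        have "inverse x * (x * y) \<in> M"
          using unit_in_L[OF xy(1) False] xy(3) M_ideal unfolding L.ideal_in_def by blast
        moreover have "inverse x * (x * y) = y"
          using \<open>x \<noteq> 0\<close> by (simp flip: mult.assoc)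
        ultimately show ?thesis by simp
      qed simp
    qed
    have v_in: "?v \<in> P_v" and u_notin: "?u \<notin> P_v"
      using P_v_iff[OF v_in_V one_in_D] P_v_iff[OF u_in_V one_in_D] not_Y_dvd_u
        dvd_trans[OF dvd_power[of k Y] Y_power_dvd_v] k_pos by auto
    have "P_v \<subseteq> M"
    proof
      fix x assume "x \<in> P_v"
      show "x \<in> M"
      proof (rule ccontr)
        assume "x \<notin> M"
        have "x \<in> L" using \<open>x \<in> P_v\<close> P_v_prime by (auto simp: L.prime_in_def L.ideal_in_def)
        have "x \<noteq> 0" using \<open>x \<notin> M\<close> M_ideal by (auto simp: L.ideal_in_def)
        then have "1 \<in> P_v"
          using unit_in_L[OF \<open>x \<in> L\<close> \<open>x \<notin> M\<close>] \<open>x \<in> P_v\<close> P_v_prime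
          unfolding L.prime_in_def L.ideal_in_def by (metis left_inverse)
        then have "?u * 1 \<in> P_v"
          using P_v_prime uvL unfolding L.prime_in_def L.ideal_in_def by blast
        then show False using u_notin by simp
      qed
    qed
    have P_v_subset: "P_v \<subseteq> L"
      using P_v_prime by (simp add: L.prime_in_def L.ideal_in_def)
    let ?P = "\<lambda>i::nat. g ` (if i = 0 then {0} else if i = 1 then P_v else M)"
    have "0 \<in> P_v"
      using P_v_prime by (simp add: L.prime_in_def L.ideal_in_def)
    then have strict: "{0} \<subset> P_v" "P_v \<subset> M"
      using v_in nz(1) \<open>P_v \<subseteq> M\<close> u_notin params_in_M(1) by blast+
    have "\<forall>i\<le>2. primeideal (?P i) A"
      using zero_prime M_prime P_v_prime primeideal_image by auto
    moreover have "\<forall>i<2. ?P i \<subset> ?P (Suc i)"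
    proof (intro allI impI)
      fix i :: nat assume "i < 2"
      then consider "i = 0" | "i = 1" by linarith
      then show "?P i \<subset> ?P (Suc i)"
      proof cases
        case 1
        then show ?thesis
          using image_strict_mono[OF inj_on_subset[OF inj P_v_subset] strict(1)] by simp
      next
        case 2
        then show ?thesis
          using image_strict_mono[OF inj_on_subset[OF inj M_subset] strict(2)] by simp
      qed
    qed
    ultimately have "enat 2 \<in> {enat n | n. \<exists>P. (\<forall>i\<le>n. primeideal (P i) A) \<and> (\<forall>i<n. P i \<subset> P (Suc i))}"
      by (intro CollectI exI[of _ 2] exI[of _ ?P] conjI refl)
    then show "2 \<le> krull_dim A"
      unfolding krull_dim_def numeral_eq_enat by (rule Sup_upper)
  qed

  have basis: "\<exists>x y b. x \<in> M \<and> y \<in> M \<and> xs ! 0 = g x \<and> xs ! 1 = g y \<and>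
      L.socle_basis_in M (L.ideal2 x y) (k - 1) b"
    if xs: "set xs \<subseteq> the_max_ideal A" "regular_sequence A xs" "2 \<le> length xs" for xs
  proof -
    have "xs ! 0 \<in> set xs" "xs ! 1 \<in> set xs"
      using xs(3) by (auto intro!: nth_mem)
    then have "xs ! 0 \<in> g ` M" "xs ! 1 \<in> g ` M"
      using xs(1) max by auto
    then obtain x y where xy: "x \<in> M" "y \<in> M" "xs ! 0 = g x" "xs ! 1 = g y" by blast
    then have "x \<in> L" "y \<in> L" using M_subset by auto
    then have "x \<noteq> 0" "L.regular_mod x y"
      using regular_sequence_modelD[OF xs(2,3) _ _ xy(3,4)] by auto
    then show ?thesis using socle_basis_exists xy by blast
  qed

  have depth: "depth A = 2"
  proof (rule antisym)
    have "regular_sequence A [g ?v, g ?u]"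
      using uvL nz regular_mod_v_u ideal2_params_proper params_in_M
      by (intro regular_sequence_pairI) auto
    moreover have "set [g ?v, g ?u] \<subseteq> the_max_ideal A"
      using params_in_M by (simp add: max)
    ultimately have "enat (length [g ?v, g ?u]) \<in>
        {enat (length xs) | xs. set xs \<subseteq> the_max_ideal A \<and> regular_sequence A xs}"
      by blast
    then have "enat 2 \<in> {enat (length xs) | xs. set xs \<subseteq> the_max_ideal A \<and> regular_sequence A xs}"
      by (simp add: numeral_2_eq_2)
    then show "2 \<le> depth A"
      unfolding depth_def numeral_eq_enat by (rule Sup_upper)
    show "depth A \<le> 2"
      unfolding depth_def
    proof (rule Sup_least, safe)
      fix xs assume xs: "set xs \<subseteq> the_max_ideal A" "regular_sequence A xs"
      show "enat (length xs) \<le> 2"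
      proof (rule ccontr)
        assume "\<not> enat (length xs) \<le> 2"
        then have len: "2 < length xs" by (simp add: numeral_eq_enat)
        then obtain x y b where xy: "x \<in> M" "y \<in> M" "xs ! 0 = g x" "xs ! 1 = g y"
          and b: "L.socle_basis_in M (L.ideal2 x y) (k - 1) b"
          using basis[OF xs] by auto
        let ?I = "L.ideal2 x y"
        have xyL: "x \<in> L" "y \<in> L" using xy M_subset by auto
        have I: "L.ideal_in ?I" by (rule L.ideal_in_ideal2[OF xyL])
        obtain z where z: "z \<in> M" "xs ! 2 = g z"
          using xs(1) len max by (metis imageE nth_mem subsetD)
        have b0: "b 0 \<in> L" "z * b 0 \<in> ?I"
          using b two_le_k z(1) unfolding L.socle_basis_in_def by auto
        have "take 2 xs = [xs ! 0, xs ! 1]"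
          by (rule nth_equalityI) (use len in \<open>auto simp: less_Suc_eq numeral_2_eq_2\<close>)
        then have gen: "genideal A (set (take 2 xs)) = g ` ?I"
          using xy genideal_pair_model[OF xyL] by simp
        have "g z \<otimes>\<^bsub>A\<^esub> g (b 0) \<in> g ` ?I"
          using b0 z M_subset by (auto simp: g_mult)
        then have "g (b 0) \<in> g ` ?I"
          using xs(2) len z b0 gen unfolding regular_sequence_def by (metis g_closed)
        then have "b 0 \<in> ?I"
          using g_mem_image_iff b0 I by (simp add: L.ideal_in_def)
        \<comment> \<open>Hence \<open>1 * b 0\<close> is a vanishing combination, so the basis would force \<open>1 \<in> M\<close>.\<close>
        moreover have "(\<Sum>i<k-1. (if i = 0 then 1 else 0) * b i) = b 0"
          using two_le_k by (simp add: if_distrib[of "\<lambda>c. c * _"] cong: if_cong)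
        ultimately have "\<forall>i<k-1. (if i = 0 then 1 else 0) \<in> M"
          using b L.closed unfolding L.socle_basis_in_def
          by (elim conjE allE[of _ "\<lambda>i. if i = 0 then 1 else 0"]) simp
        then have "(if (0::nat) = 0 then 1 else 0) \<in> M"
          using two_le_k by (elim allE[of _ 0]) simp
        then show False using one_notin_M by simp
      qed
    qed
  qed

  show ?thesis
    unfolding has_cohen_macaulay_type_def cohen_macaulay_local_def
  proof (intro conjI allI impI local)
    show "depth A = krull_dim A" using depth dim by simp
    fix xs assume xs: "set xs \<subseteq> the_max_ideal A \<and> regular_sequence A xs \<and> enat (length xs) = krull_dim A"
    then have len: "length xs = 2" using dim by (simp add: numeral_eq_enat)
    then obtain x y b where xy: "x \<in> M" "y \<in> M" "xs ! 0 = g x" "xs ! 1 = g y"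
      and b: "L.socle_basis_in M (L.ideal2 x y) (k - 1) b"
      using basis[of xs] xs by auto
    have xyL: "x \<in> L" "y \<in> L" using xy M_subset by auto
    have "xs = [g x, g y]"
      using len xy by (auto simp: list_eq_iff_nth_eq less_Suc_eq numeral_2_eq_2)
    then have gen: "genideal A (set xs) = g ` L.ideal2 x y"
      using genideal_pair_model[OF xyL] by simp
    show "\<exists>v. socle_basis A (genideal A (set xs)) (k - 1) v"
      unfolding gen using socle_basis_model[OF L.ideal_in_ideal2[OF xyL] M_subset max b] by blast
  qed
qed

end

section \<open>Localization\<close>

context cone_over_normal_curve
begin

definition V_max :: "'k poly poly set" where
  "V_max = {p \<in> V. coeff p 0 = 0}"

text \<open>The class of a fraction in the localization consists of all pairs that represent the same element of
\<open>K(X, Y)\<close>.\<close>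

definition fraction_class :: "('k poly poly \<Rightarrow> 'a) \<Rightarrow> 'k poly poly fract \<Rightarrow> ('a \<times> 'a) set" where
  "fraction_class g z = {(g p, g q) | p q. p \<in> V \<and> q \<in> D \<and> to_fract p / to_fract q = z}"

text \<open>In a domain two fractions are equivalent iff they have the same value in the field of fractions. So
the operations on classes, which are unions over all representatives, are unions of one and the same
class (\<open>union2\<close>).\<close>

lemma localization_model:
  fixes R :: "('a, 'b) ring_scheme"
  assumes "ring_model V R g"
  shows "ring_model L (localization R (g ` V_max)) (fraction_class g)"
proof -
  interpret R: ring_model V R g by fact
  let ?P = "g ` V_max" and ?F = "fraction_class g"
  have D_sub: "D \<subseteq> V" using D_in_V by blast
  have units: "carrier R - ?P = g ` D"
  proof -
    have "carrier R - ?P = g ` (V - V_max)"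
      unfolding R.carrier_eq using R.inj
      by (subst inj_on_image_set_diff[of g V]) (auto simp: V_max_def)
    also have "V - V_max = D" by (auto simp: V_max_def D_def)
    finally show ?thesis .
  qed
  have rel: "((g r, g s), (g r', g s')) \<in> fraction_rel R ?P \<longleftrightarrow>
      to_fract r / to_fract s = to_fract r' / to_fract s'"
    if mem: "r \<in> V" "s \<in> D" "r' \<in> V" "s' \<in> D" for r s r' s'
  proof -
    have V: "s \<in> V" "s' \<in> V" using mem D_in_V by auto
    have "g t \<otimes>\<^bsub>R\<^esub> ((g r \<otimes>\<^bsub>R\<^esub> g s') \<ominus>\<^bsub>R\<^esub> (g r' \<otimes>\<^bsub>R\<^esub> g s)) = \<zero>\<^bsub>R\<^esub> \<longleftrightarrow> r * s' = r' * s" if "t \<in> D" for t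
    proof -
      have "g t \<otimes>\<^bsub>R\<^esub> ((g r \<otimes>\<^bsub>R\<^esub> g s') \<ominus>\<^bsub>R\<^esub> (g r' \<otimes>\<^bsub>R\<^esub> g s)) = g (t * (r * s' - r' * s))"
        using mem V D_in_V[OF that] by (simp add: R.g_mult R.g_diff V.closed)
      then show ?thesis
        using R.g_eq_iff[of "t * (r * s' - r' * s)" 0] mem V D_in_V[OF that] D_nonzero[OF that]
        by (simp add: R.g_zero V.closed)
    qed
    then have "((g r, g s), (g r', g s')) \<in> fraction_rel R ?P \<longleftrightarrow> r * s' = r' * s"
      unfolding fraction_rel_def units using mem one_in_D R.g_closed by auto
    then show ?thesis
      unfolding fract_eq_iff[OF D_nonzero[OF mem(2)] D_nonzero[OF mem(4)]] .
  qed
  have rel_dom: "fraction_rel R ?P \<subseteq> (g ` V \<times> g ` D) \<times> (g ` V \<times> g ` D)"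
  proof
    fix x assume x: "x \<in> fraction_rel R ?P"
    obtain r s r' s' where "x = ((r, s), (r', s'))"
      by (metis prod.exhaust)
    then show "x \<in> (g ` V \<times> g ` D) \<times> (g ` V \<times> g ` D)"
      using x unfolding fraction_rel_def units by (simp add: R.carrier_eq)
  qed
  have frac: "fraction R ?P (g r) (g s) = ?F (to_fract r / to_fract s)" if "r \<in> V" "s \<in> D" for r s
  proof
    show "fraction R ?P (g r) (g s) \<subseteq> ?F (to_fract r / to_fract s)"
    proof
      fix x assume "x \<in> fraction R ?P (g r) (g s)"
      then have x: "((g r, g s), x) \<in> fraction_rel R ?P" by (simp add: fraction_def)
      then have "x \<in> g ` V \<times> g ` D"
        using rel_dom by (metis (no_types) mem_Sigma_iff subsetD)
      then obtain r' s' where "r' \<in> V" "s' \<in> D" "x = (g r', g s')"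
        by auto
      then show "x \<in> ?F (to_fract r / to_fract s)"
        using rel[OF that] x by (auto simp: fraction_class_def)
    qed
    show "?F (to_fract r / to_fract s) \<subseteq> fraction R ?P (g r) (g s)"
      using rel[OF that] by (auto simp: fraction_class_def fraction_def)
  qed
  have F_mem: "(g p, g q) \<in> ?F (to_fract p / to_fract q)" if "p \<in> V" "q \<in> D" for p q
    using that by (auto simp: fraction_class_def)
  have FE: "\<exists>p q. p \<in> V \<and> q \<in> D \<and> x = (g p, g q) \<and> to_fract p / to_fract q = z" if "x \<in> ?F z" for x z
    using that by (auto simp: fraction_class_def)
  have F_ne: "?F z \<noteq> {}" if "z \<in> L" for z
    using that F_mem by (metis LE empty_iff)
  let ?A = "localization R ?P"
  have union2: "(\<Union>x\<in>?F z. case x of (r, s) \<Rightarrow> \<Union>y\<in>?F w. case y of (r', s') \<Rightarrow> f r s r' s') = C"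
    if zw: "z \<in> L" "w \<in> L"
      and const: "\<And>r s r' s'. r \<in> V \<Longrightarrow> s \<in> D \<Longrightarrow> r' \<in> V \<Longrightarrow> s' \<in> D \<Longrightarrow> to_fract r / to_fract s = z \<Longrightarrow>
        to_fract r' / to_fract s' = w \<Longrightarrow> f (g r) (g s) (g r') (g s') = C"
    for z w f and C :: "('a \<times> 'a) set"
  proof -
    have inner: "(\<Union>y\<in>?F w. case y of (r', s') \<Rightarrow> f (g r) (g s) r' s') = C"
      if rs: "r \<in> V" "s \<in> D" "to_fract r / to_fract s = z" for r s
    proof -
      have "(case y of (r', s') \<Rightarrow> f (g r) (g s) r' s') = C" if "y \<in> ?F w" for y
        using FE[OF that] rs const by auto
      then show ?thesis using F_ne[OF zw(2)] by auto
    qed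
    have "(case x of (r, s) \<Rightarrow> \<Union>y\<in>?F w. case y of (r', s') \<Rightarrow> f r s r' s') = C" if x: "x \<in> ?F z" for x
    proof -
      obtain r s where rs: "r \<in> V" "s \<in> D" "x = (g r, g s)" "to_fract r / to_fract s = z"
        using FE[OF x] by blast
      then show ?thesis using inner[OF rs(1,2,4)] by simp
    qed
    then show ?thesis using F_ne[OF zw(1)] by auto
  qed
  show ?thesis
  proof
    have "carrier ?A = (carrier R \<times> g ` D) // fraction_rel R ?P"
      by (simp add: localization_def units)
    also have "\<dots> = (\<lambda>(r, s). fraction R ?P r s) ` (g ` V \<times> g ` D)"
      unfolding R.carrier_eq quotient_def fraction_def by auto
    also have "\<dots> = ?F ` L"
    proof
      show "(\<lambda>(r, s). fraction R ?P r s) ` (g ` V \<times> g ` D) \<subseteq> ?F ` L"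
        using LI by (auto simp: frac)
      show "?F ` L \<subseteq> (\<lambda>(r, s). fraction R ?P r s) ` (g ` V \<times> g ` D)"
      proof
        fix X assume "X \<in> ?F ` L"
        then obtain p q where "p \<in> V" "q \<in> D" "X = ?F (to_fract p / to_fract q)"
          by (auto elim: LE)
        then show "X \<in> (\<lambda>(r, s). fraction R ?P r s) ` (g ` V \<times> g ` D)"
          using frac by (intro image_eqI[of _ _ "(g p, g q)"]) auto
      qed
    qed
    finally show "carrier ?A = ?F ` L" .
    show "inj_on ?F L"
    proof (rule inj_onI)
      fix z w assume "z \<in> L" "w \<in> L" and eq: "?F z = ?F w"
      then obtain p q where pq: "p \<in> V" "q \<in> D" "z = to_fract p / to_fract q" by (elim LE)
      then have "(g p, g q) \<in> ?F w" using F_mem eq by blast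
      then obtain p' q' where p'q': "p' \<in> V" "q' \<in> D" "g p = g p'" "g q = g q'" "w = to_fract p' / to_fract q'"
        by (auto simp: fraction_class_def)
      then show "z = w"
        using pq R.g_eq_iff D_in_V by metis
    qed
    show "\<one>\<^bsub>?A\<^esub> = ?F 1"
      using frac[OF V.one_closed one_in_D] by (simp add: localization_def R.g_one)
    show "\<zero>\<^bsub>?A\<^esub> = ?F 0"
      using frac[OF V.zero_closed one_in_D] by (simp add: localization_def R.g_one R.g_zero)
    fix z w assume zw: "z \<in> L" "w \<in> L"
    show "?F z \<otimes>\<^bsub>?A\<^esub> ?F w = ?F (z * w)"
      unfolding localization_def monoid.simps
    proof (rule union2[OF zw])
      fix r s r' s' assume *: "r \<in> V" "s \<in> D" "r' \<in> V" "s' \<in> D" "to_fract r / to_fract s = z"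
        "to_fract r' / to_fract s' = w"
      then show "fraction R ?P (g r \<otimes>\<^bsub>R\<^esub> g r') (g s \<otimes>\<^bsub>R\<^esub> g s') = ?F (z * w)"
        using frac[of "r * r'" "s * s'"] V.closed D_mult D_in_V by (auto simp: R.g_mult)
    qed
    show "?F z \<oplus>\<^bsub>?A\<^esub> ?F w = ?F (z + w)"
      unfolding localization_def ring_record_simps
    proof (rule union2[OF zw])
      fix r s r' s' assume *: "r \<in> V" "s \<in> D" "r' \<in> V" "s' \<in> D" "to_fract r / to_fract s = z"
        "to_fract r' / to_fract s' = w"
      have V: "s \<in> V" "s' \<in> V" using * D_in_V by auto
      have "z + w = to_fract (r * s' + r' * s) / to_fract (s * s')"
        using *(5,6) D_nonzero[OF *(2)] D_nonzero[OF *(4)] by (auto simp: add_frac_eq)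
      then show "fraction R ?P ((g r \<otimes>\<^bsub>R\<^esub> g s') \<oplus>\<^bsub>R\<^esub> (g r' \<otimes>\<^bsub>R\<^esub> g s)) (g s \<otimes>\<^bsub>R\<^esub> g s') = ?F (z + w)"
        using frac[of "r * s' + r' * s" "s * s'"] V *(1-4) D_mult
        by (simp add: R.g_mult R.g_add V.closed)
    qed
  qed
qed

end

section \<open>The semigroup and its quasi-Frobenius elements\<close>

lemma int_vec_add: "int_vec (x + y) = int_vec x + int_vec y"
  by (simp add: int_vec_def vec_eq_iff)

lemma int_vec_eq_iff: "int_vec x = int_vec y \<longleftrightarrow> x = y"
  by (simp add: int_vec_def vec_eq_iff)

lemma sum_of_monomials: "p = (\<Sum>s\<in>Poly_Mapping.keys p. Poly_Mapping.single s (Poly_Mapping.lookup p s))"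
  by (rule poly_mapping_eqI) (simp add: Poly_Mapping.lookup_sum Poly_Mapping.lookup_single when_def in_keys_iff)

locale arithmetic_semigroup = cone_over_normal_curve k field_type
  for k and field_type :: "'k::field itself" +
  fixes a d :: "nat ^ 'n"
  assumes indep: "lin_indep_rat a d"
begin

definition point :: "nat \<times> nat \<Rightarrow> nat ^ 'n" where
  "point = (\<lambda>(m, j). m *s a + j *s d)"

definition S :: "(nat ^ 'n) set" where
  "S = {point (m, j) | m j. j \<le> k * m}"

lemma point_nth: "point (m, j) $ i = m * a $ i + j * d $ i"
  by (simp add: point_def)

lemma inj_point: "inj point"
proof (rule injI, clarify)
  fix m j m' j' assume "point (m, j) = point (m', j')"
  then have "m * a $ i + j * d $ i = m' * a $ i + j' * d $ i" for i
    by (metis point_nth)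
  then have "of_nat m * of_nat (a $ i) + of_nat j * of_nat (d $ i)
      = of_nat m' * of_nat (a $ i) + (of_nat j' * of_nat (d $ i) :: rat)" for i
    by (metis of_nat_add of_nat_mult)
  then have "(of_nat m - of_nat m') * of_nat (a $ i) + (of_nat j - of_nat j') * of_nat (d $ i) = (0::rat)" for i
    by (simp add: algebra_simps)
  then have "of_nat m - of_nat m' = (0::rat)" "of_nat j - of_nat j' = (0::rat)"
    using indep unfolding lin_indep_rat_def by blast+
  then show "m = m' \<and> j = j'" by simp
qed

lemma point_eq_iff: "point x = point y \<longleftrightarrow> x = y"
  using inj_point by (auto dest: injD)

lemma point_add: "point (m, j) + point (m', j') = point (m + m', j + j')"
  by (simp add: vec_eq_iff point_nth algebra_simps)

lemma point_zero: "point (0, 0) = 0"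
  by (simp add: vec_eq_iff point_nth)

lemma point_in_S_iff: "point (m, j) \<in> S \<longleftrightarrow> j \<le> k * m"
  by (auto simp: S_def point_eq_iff)

lemma SE:
  assumes "s \<in> S"
  obtains m j where "j \<le> k * m" "s = point (m, j)"
  using assms unfolding S_def by blast

lemma S_add: "s \<in> S \<Longrightarrow> t \<in> S \<Longrightarrow> s + t \<in> S"
  by (elim SE) (auto simp: point_add point_in_S_iff algebra_simps)

text \<open>A sum of \<open>m\<close> generators \<open>a + i d\<close> with \<open>i \<le> k\<close> is \<open>m a + j d\<close> with \<open>j \<le> k m\<close>. Conversely, split off the
generator with \<open>i = min j k\<close> and use induction on \<open>m\<close>.\<close>

lemma affine_semigroup_eq: "affine_semigroup (arith_gens a d k) = S"
proof
  have gen: "arith_gens a d k = (\<lambda>i. point (1, i)) ` {0..k}"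
    by (auto simp: arith_gens_def point_def vec_eq_iff intro!: image_cong)
  have inj: "inj_on (\<lambda>i. point (1, i)) {0..k}"
    by (auto simp: inj_on_def point_eq_iff)
  have comb: "(\<Sum>x\<in>arith_gens a d k. l x *s x) = (\<Sum>i\<in>{0..k}. l (point (1, i)) *s point (1, i))" for l
    unfolding gen by (subst sum.reindex[OF inj]) simp
  show "affine_semigroup (arith_gens a d k) \<subseteq> S"
  proof
    fix s assume "s \<in> affine_semigroup (arith_gens a d k)"
    then obtain l where s: "s = (\<Sum>i\<in>{0..k}. l (point (1, i)) *s point (1, i))"
      unfolding affine_semigroup_def comb by blast
    have "(\<Sum>i\<in>I. l (point (1, i)) *s point (1, i)) \<in> S" if "I \<subseteq> {0..k}" for I
      using finite_subset[OF that finite_atLeastAtMost] that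
    proof (induction I rule: finite_induct)
      case empty
      then show ?case using point_in_S_iff[of 0 0] by (simp add: point_zero)
    next
      case (insert i I)
      have "l (point (1, i)) *s point (1, i) = point (l (point (1, i)), l (point (1, i)) * i)"
        by (simp add: vec_eq_iff point_nth algebra_simps)
      also have "\<dots> \<in> S"
        using insert.prems by (simp add: point_in_S_iff mult.commute)
      finally show ?case using insert by (auto intro: S_add)
    qed
    then show "s \<in> S" using s by blast
  qed
  have add: "s + t \<in> affine_semigroup (arith_gens a d k)"
    if st: "s \<in> affine_semigroup (arith_gens a d k)" "t \<in> affine_semigroup (arith_gens a d k)" for s t
  proof -
    obtain l l' where "s = (\<Sum>x\<in>arith_gens a d k. l x *s x)" "t = (\<Sum>x\<in>arith_gens a d k. l' x *s x)"
      using st unfolding affine_semigroup_def by blast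
    then have "s + t = (\<Sum>x\<in>arith_gens a d k. (l x + l' x) *s x)"
      by (simp add: sum.distrib vec_eq_iff algebra_simps)
    then show ?thesis
      unfolding affine_semigroup_def by (intro CollectI exI[of _ "\<lambda>x. l x + l' x"]) simp
  qed
  have gen_mem: "point (1, j) \<in> affine_semigroup (arith_gens a d k)" if "j \<le> k" for j
  proof -
    let ?l = "\<lambda>x. if x = point (1, j) then 1 else (0::nat)"
    have "(\<Sum>x\<in>arith_gens a d k. ?l x *s x) = (\<Sum>x\<in>{point (1, j)}. ?l x *s x)"
      by (rule sum.mono_neutral_right) (use that in \<open>auto simp: gen vec_eq_iff\<close>)
    also have "\<dots> = point (1, j)" by (simp add: vec_eq_iff)
    finally have "point (1, j) = (\<Sum>x\<in>arith_gens a d k. ?l x *s x)" ..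
    then show ?thesis
      unfolding affine_semigroup_def by (intro CollectI exI[of _ ?l] conjI TrueI)
  qed
  have "point (m, j) \<in> affine_semigroup (arith_gens a d k)" if "j \<le> k * m" for m j
    using that
  proof (induction m arbitrary: j)
    case 0
    have "0 = (\<Sum>x\<in>arith_gens a d k. (0::nat) *s x)" by (simp add: vec_eq_iff)
    then have "0 \<in> affine_semigroup (arith_gens a d k)"
      unfolding affine_semigroup_def by (intro CollectI exI[of _ "\<lambda>_. 0"] conjI TrueI)
    then show ?case using 0 by (simp add: point_zero)
  next
    case (Suc m)
    have "point (Suc m, j) = point (1, min j k) + point (m, j - min j k)"
      by (simp add: point_add)
    moreover have "j - min j k \<le> k * m" using Suc.prems by (auto simp: min_def)
    ultimately show ?case using add gen_mem Suc.IH by simp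
  qed
  then show "S \<subseteq> affine_semigroup (arith_gens a d k)" by (auto elim: SE)
qed

lemma diff_in_S_iff: "int_vec y - int_vec x \<in> int_vec ` S \<longleftrightarrow> (\<exists>s\<in>S. y = x + s)"
proof -
  have "int_vec y - int_vec x = int_vec s \<longleftrightarrow> y = x + s" for s
    by (metis add_diff_cancel_left' add_diff_eq int_vec_add int_vec_eq_iff)
  then show ?thesis by auto
qed

lemma point_diff_in_S_iff:
  "int_vec (point (m, j)) - int_vec (point (m', j')) \<in> int_vec ` S \<longleftrightarrow>
    m' \<le> m \<and> j' \<le> j \<and> j - j' \<le> k * (m - m')"
  unfolding diff_in_S_iff
proof
  assume "\<exists>s\<in>S. point (m, j) = point (m', j') + s"
  then show "m' \<le> m \<and> j' \<le> j \<and> j - j' \<le> k * (m - m')"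
    by (auto elim!: SE simp: point_add point_eq_iff)
next
  assume *: "m' \<le> m \<and> j' \<le> j \<and> j - j' \<le> k * (m - m')"
  then show "\<exists>s\<in>S. point (m, j) = point (m', j') + s"
    by (intro bexI[of _ "point (m - m', j - j')"]) (auto simp: point_add point_in_S_iff)
qed

text \<open>For \<open>m \<ge> 2\<close> the ranges \<open>j \<le> k (m - 1)\<close> and \<open>j \<ge> k\<close> cover everything, so one of the two rays can be
subtracted. For \<open>m = 1\<close> they leave out exactly \<open>0 < j < k\<close>.\<close>

lemma apery_set_eq:
  "apery_set S {point (1, 0), point (1, k)} = insert (point (0, 0)) ((\<lambda>j. point (1, j)) ` {0<..<k})"
proof -
  have "(\<not> (1 \<le> m \<and> 0 \<le> j \<and> j - 0 \<le> k * (m - 1)) \<and> \<not> (1 \<le> m \<and> k \<le> j \<and> j - k \<le> k * (m - 1))) \<longleftrightarrow>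
      m = 0 \<and> j = 0 \<or> m = 1 \<and> 0 < j \<and> j < k" if "j \<le> k * m" for m j
  proof (cases m)
    case (Suc n)
    show ?thesis
    proof (cases n)
      case 0
      then show ?thesis using Suc that by auto
    next
      case (Suc n')
      have "k \<le> k * n" using Suc by simp
      then show ?thesis using \<open>m = Suc n\<close> Suc that by auto
    qed
  qed (use that in auto)
  then have mem: "point (m, j) \<in> apery_set S {point (1, 0), point (1, k)} \<longleftrightarrow>
      m = 0 \<and> j = 0 \<or> m = 1 \<and> 0 < j \<and> j < k" if "j \<le> k * m" for m j
    unfolding apery_set_def using that by (simp add: point_diff_in_S_iff point_in_S_iff)
  show ?thesis
  proof (intro equalityI subsetI)
    fix b assume b: "b \<in> apery_set S {point (1, 0), point (1, k)}"
    then have "b \<in> S" by (simp add: apery_set_def)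
    then obtain m j where mj: "j \<le> k * m" "b = point (m, j)" by (elim SE)
    then have "m = 0 \<and> j = 0 \<or> m = 1 \<and> 0 < j \<and> j < k"
      using mem b by simp
    then show "b \<in> insert (point (0, 0)) ((\<lambda>j. point (1, j)) ` {0<..<k})"
      using mj(2) by auto
  next
    fix b assume "b \<in> insert (point (0, 0)) ((\<lambda>j. point (1, j)) ` {0<..<k})"
    then consider "b = point (0, 0)" | j where "b = point (1, j)" "0 < j" "j < k" by auto
    then show "b \<in> apery_set S {point (1, 0), point (1, k)}"
      by cases (use mem[of 0 0] mem[of _ 1] in auto)
  qed
qed

text \<open>The elements with \<open>m = 1\<close> differ by elements with \<open>m = 0\<close>, and the only such element of \<open>S\<close> is \<open>0\<close>.\<close>

lemma maximal_apery_eq: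
  "maximal_elements S (apery_set S {point (1, 0), point (1, k)}) = (\<lambda>j. point (1, j)) ` {0<..<k}"
  unfolding maximal_elements_def apery_set_eq semigroup_le_def
proof (intro equalityI subsetI)
  fix b assume b: "b \<in> {b \<in> insert (point (0, 0)) ((\<lambda>j. point (1, j)) ` {0<..<k}).
    \<forall>c\<in>insert (point (0, 0)) ((\<lambda>j. point (1, j)) ` {0<..<k}).
      int_vec c - int_vec b \<in> int_vec ` S \<longrightarrow> c = b}"
  have "b \<noteq> point (0, 0)"
  proof
    assume "b = point (0, 0)"
    moreover have "point (1, 1) \<in> (\<lambda>j. point (1, j)) ` {0<..<k}"
      using two_le_k by auto
    ultimately have "point (1, 1) = point (0, 0)"
      using b point_diff_in_S_iff[of 1 1 0 0] two_le_k by auto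
    then show False by (simp add: point_eq_iff)
  qed
  then show "b \<in> (\<lambda>j. point (1, j)) ` {0<..<k}" using b by auto
next
  fix b assume "b \<in> (\<lambda>j. point (1, j)) ` {0<..<k}"
  then obtain j where j: "b = point (1, j)" "0 < j" "j < k" by auto
  have same: "point (m, i) = point (1, j)"
    if diff: "int_vec (point (m, i)) - int_vec (point (1, j)) \<in> int_vec ` S" "m \<le> 1" for m i
  proof -
    have mi: "1 \<le> m" "j \<le> i" "i - j \<le> k * (m - 1)"
      using diff(1) unfolding point_diff_in_S_iff by blast+
    then have "m = 1" using diff(2) by simp
    then show ?thesis using mi by simp
  qed
  have "c = b" if c: "c \<in> insert (point (0, 0)) ((\<lambda>j. point (1, j)) ` {0<..<k})"
      "int_vec c - int_vec b \<in> int_vec ` S" for c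
  proof -
    consider "c = point (0, 0)" | i where "c = point (1, i)"
      using c(1) by blast
    then show ?thesis
      using same c(2) unfolding j(1) by cases (simp_all only: order_refl zero_le)
  qed
  then show "b \<in> {b \<in> insert (point (0, 0)) ((\<lambda>j. point (1, j)) ` {0<..<k}).
    \<forall>c\<in>insert (point (0, 0)) ((\<lambda>j. point (1, j)) ` {0<..<k}).
      int_vec c - int_vec b \<in> int_vec ` S \<longrightarrow> c = b}"
    using j by (intro CollectI conjI ballI impI insertI2 image_eqI[of _ _ j]) simp_all
qed

lemma quasi_frobenius_eq:
  "quasi_frobenius S {a, a + k *s d} = (\<lambda>i. - int_vec (a + i *s d)) ` {1..k - 1}"
proof -
  have shift: "a + i *s d = point (1, i)" for i
    by (simp add: vec_eq_iff point_nth)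
  then have E: "{a, a + k *s d} = {point (1, 0), point (1, k)}"
    using shift[of 0] by simp
  have "int_vec (point (1, j)) - (int_vec (point (1, 0)) + int_vec (point (1, k)))
      = - int_vec (point (1, k - j))" if "j \<le> k" for j
  proof -
    have "point (1, j) + point (1, k - j) = point (1, 0) + point (1, k)"
      using that by (simp add: point_add)
    then have "int_vec (point (1, j)) + int_vec (point (1, k - j))
        = int_vec (point (1, 0)) + int_vec (point (1, k))"
      by (simp only: flip: int_vec_add)
    then show ?thesis by (simp add: algebra_simps)
  qed
  moreover have "point (1, 0) \<noteq> point (1, k)"
    using two_le_k by (simp add: point_eq_iff)
  ultimately have "quasi_frobenius S {a, a + k *s d}
      = (\<lambda>j. - int_vec (point (1, k - j))) ` {0<..<k}"
    unfolding quasi_frobenius_def E maximal_apery_eq image_image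
    by (intro image_cong) auto
  also have "\<dots> = (\<lambda>i. - int_vec (point (1, i))) ` ((\<lambda>j. k - j) ` {0<..<k})"
    by (simp add: image_image)
  also have "(\<lambda>j. k - j) ` {0<..<k} = {1..k - 1}"
  proof -
    have "i \<in> (\<lambda>j. k - j) ` {0<..<k}" if "i \<in> {1..k - 1}" for i
      by (rule image_eqI[of _ _ "k - i"]) (use that in auto)
    then show ?thesis by auto
  qed
  finally show ?thesis by (simp add: shift)
qed

section \<open>The semigroup ring\<close>

definition coords :: "nat ^ 'n \<Rightarrow> nat \<times> nat" where "coords = inv_into UNIV point"

lemma coords_point [simp]: "coords (point x) = x"
  unfolding coords_def by (simp add: inv_into_f_f[OF inj_point])

abbreviation K_S :: "((nat ^ 'n) \<Rightarrow>\<^sub>0 'k) ring" where "K_S \<equiv> semigroup_ring S"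

definition to_poly :: "((nat ^ 'n) \<Rightarrow>\<^sub>0 'k) \<Rightarrow> 'k poly poly" where
  "to_poly p = (\<Sum>s\<in>Poly_Mapping.keys p.
     monom (monom (Poly_Mapping.lookup p s) (snd (coords s))) (fst (coords s)))"

lemma carrier_K_S: "p \<in> carrier K_S \<longleftrightarrow> Poly_Mapping.keys p \<subseteq> S"
  by (simp add: semigroup_ring_def)

lemma coeff_to_poly:
  assumes "p \<in> carrier K_S"
  shows "coeff (coeff (to_poly p) m) j = Poly_Mapping.lookup p (point (m, j))"
proof -
  have "coeff (coeff (to_poly p) m) j
      = (\<Sum>s\<in>Poly_Mapping.keys p. if coords s = (m, j) then Poly_Mapping.lookup p s else 0)"
    unfolding to_poly_def coeff_sum by (intro sum.cong) (auto simp: coeff_monom prod_eq_iff)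
  also have "\<dots> = (\<Sum>s\<in>Poly_Mapping.keys p. if s = point (m, j) then Poly_Mapping.lookup p s else 0)"
    using assms by (intro sum.cong) (auto simp: carrier_K_S subset_iff elim!: SE)
  also have "\<dots> = Poly_Mapping.lookup p (point (m, j))"
    by (simp add: in_keys_iff)
  finally show ?thesis .
qed

lemma lookup_outside_S:
  assumes "p \<in> carrier K_S" "s \<notin> S"
  shows "Poly_Mapping.lookup p s = 0"
  using assms by (auto simp: carrier_K_S in_keys_iff subset_iff)

lemma to_poly_in_V:
  assumes "p \<in> carrier K_S"
  shows "to_poly p \<in> V"
  unfolding V_def
proof (clarify, rule degree_le, clarify)
  fix m j assume "k * m < j"
  then show "coeff (coeff (to_poly p) m) j = 0"
    using lookup_outside_S[OF assms] by (simp add: coeff_to_poly[OF assms] point_in_S_iff)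
qed

lemma to_poly_eqI:
  assumes "p \<in> carrier K_S" "\<And>m j. Poly_Mapping.lookup p (point (m, j)) = coeff (coeff q m) j"
  shows "to_poly p = q"
  by (intro poly_eqI) (simp add: coeff_to_poly[OF assms(1)] assms(2))

lemma inj_to_poly: "inj_on to_poly (carrier K_S)"
proof (rule inj_onI)
  fix p q assume pq: "p \<in> carrier K_S" "q \<in> carrier K_S" "to_poly p = to_poly q"
  have "Poly_Mapping.lookup p s = Poly_Mapping.lookup q s" for s
  proof (cases "s \<in> S")
    case True
    then obtain m j where "s = point (m, j)" by (elim SE)
    then show ?thesis using pq coeff_to_poly by metis
  qed (simp add: lookup_outside_S pq)
  then show "p = q" by (rule poly_mapping_eqI)
qed

lemma to_poly_onto: 
  assumes "q \<in> V"
  shows "\<exists>p\<in>carrier K_S. to_poly p = q"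
proof -
  let ?c = "\<lambda>s. if s \<in> S then coeff (coeff q (fst (coords s))) (snd (coords s)) else 0"
  have "{s. ?c s \<noteq> 0} \<subseteq> point ` (SIGMA m:{..Polynomial.degree q}. {..k * m})"
  proof
    fix s assume "s \<in> {s. ?c s \<noteq> 0}"
    then have "s \<in> S" "?c s \<noteq> 0" by (auto split: if_splits)
    then obtain m j where s: "s = point (m, j)" "j \<le> k * m" "coeff (coeff q m) j \<noteq> 0"
      by (auto elim!: SE)
    then have "m \<le> Polynomial.degree q"
      by (metis coeff_0 le_degree)
    then show "s \<in> point ` (SIGMA m:{..Polynomial.degree q}. {..k * m})"
      using s by auto
  qed
  then have fin: "finite {s. ?c s \<noteq> 0}"
    by (rule finite_subset) auto
  let ?p = "Abs_poly_mapping ?c"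
  have look: "Poly_Mapping.lookup ?p = ?c"
    using fin by (rule Poly_Mapping.lookup_Abs_poly_mapping)
  have "?p \<in> carrier K_S"
    unfolding carrier_K_S by (auto simp: in_keys_iff look split: if_splits)
  moreover have "to_poly ?p = q"
  proof (rule to_poly_eqI[OF calculation])
    fix m j
    show "Poly_Mapping.lookup ?p (point (m, j)) = coeff (coeff q m) j"
    proof (cases "j \<le> k * m")
      case False
      then have "coeff (coeff q m) j = 0"
        using VD[OF assms, of m] by (intro coeff_eq_0) simp
      then show ?thesis using False by (simp add: look point_in_S_iff)
    qed (simp add: look point_in_S_iff)
  qed
  ultimately show ?thesis by blast
qed

lemma K_S_sum_closed: "(\<And>i. i \<in> I \<Longrightarrow> f i \<in> carrier K_S) \<Longrightarrow> sum f I \<in> carrier K_S"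
  unfolding carrier_K_S using keys_sum[of f I] by blast

lemma to_poly_add:
  assumes "p \<in> carrier K_S" "q \<in> carrier K_S"
  shows "to_poly (p + q) = to_poly p + to_poly q"
proof (rule to_poly_eqI)
  show "p + q \<in> carrier K_S"
    using assms Poly_Mapping.keys_add[of p q] by (auto simp: carrier_K_S)
qed (simp add: Poly_Mapping.lookup_add coeff_to_poly assms)

lemma to_poly_sum:
  assumes "\<And>i. i \<in> I \<Longrightarrow> f i \<in> carrier K_S"
  shows "to_poly (sum f I) = (\<Sum>i\<in>I. to_poly (f i))"
  using assms
proof (induction I rule: infinite_finite_induct)
  case (insert i I)
  then show ?case by (simp add: to_poly_add K_S_sum_closed)
qed (simp_all add: to_poly_def)

lemma single_in_K_S: "s \<in> S \<Longrightarrow> Poly_Mapping.single s c \<in> carrier K_S"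
  by (simp add: carrier_K_S)

lemma to_poly_single:
  assumes "j \<le> k * m"
  shows "to_poly (Poly_Mapping.single (point (m, j)) c) = monom (monom c j) m"
  using assms by (intro to_poly_eqI single_in_K_S)
    (auto simp: point_in_S_iff Poly_Mapping.lookup_single when_def point_eq_iff coeff_monom)

text \<open>By bilinearity this reduces to monomials, where it is additivity of the exponents.\<close>

lemma to_poly_mult:
  assumes pq: "p \<in> carrier K_S" "q \<in> carrier K_S"
  shows "to_poly (p * q) = to_poly p * to_poly q"
proof -
  let ?x = "\<lambda>s. Poly_Mapping.single s (Poly_Mapping.lookup p s)" and ?y = "\<lambda>t. Poly_Mapping.single t (Poly_Mapping.lookup q t)"
  have S: "s \<in> S" "t \<in> S" if "s \<in> Poly_Mapping.keys p" "t \<in> Poly_Mapping.keys q" for s t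
    using pq that by (auto simp: carrier_K_S)
  have single: "to_poly (?x s * ?y t) = to_poly (?x s) * to_poly (?y t)" if st: "s \<in> S" "t \<in> S" for s t
  proof -
    obtain m j m' j' where mj: "j \<le> k * m" "s = point (m, j)" "j' \<le> k * m'" "t = point (m', j')"
      using st by (elim SE)
    then have "j + j' \<le> k * (m + m')" by (simp add: algebra_simps)
    then show ?thesis
      using mj by (simp add: mult_single point_add to_poly_single mult_monom)
  qed
  have "p * q = (\<Sum>s\<in>Poly_Mapping.keys p. ?x s) * (\<Sum>t\<in>Poly_Mapping.keys q. ?y t)"
    by (simp flip: sum_of_monomials)
  also have "\<dots> = (\<Sum>s\<in>Poly_Mapping.keys p. \<Sum>t\<in>Poly_Mapping.keys q. ?x s * ?y t)"
    by (rule sum_product)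
  finally have "to_poly (p * q)
      = (\<Sum>s\<in>Poly_Mapping.keys p. \<Sum>t\<in>Poly_Mapping.keys q. to_poly (?x s * ?y t))"
    using S by (simp add: to_poly_sum K_S_sum_closed mult_single single_in_K_S S_add)
  also have "\<dots> = (\<Sum>s\<in>Poly_Mapping.keys p. \<Sum>t\<in>Poly_Mapping.keys q. to_poly (?x s) * to_poly (?y t))"
    using S single by (intro sum.cong refl) blast
  also have "\<dots> = (\<Sum>s\<in>Poly_Mapping.keys p. to_poly (?x s)) * (\<Sum>t\<in>Poly_Mapping.keys q. to_poly (?y t))"
    by (rule sum_product[symmetric])
  also have "\<dots> = to_poly (\<Sum>s\<in>Poly_Mapping.keys p. ?x s) * to_poly (\<Sum>t\<in>Poly_Mapping.keys q. ?y t)"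
    using pq by (subst (1 2) to_poly_sum) (auto simp: carrier_K_S)
  finally show ?thesis by (simp flip: sum_of_monomials)
qed

lemma K_S_mult_closed: "p \<in> carrier K_S \<Longrightarrow> q \<in> carrier K_S \<Longrightarrow> p * q \<in> carrier K_S"
  using keys_mult[of p q] S_add unfolding carrier_K_S by blast

definition of_poly :: "'k poly poly \<Rightarrow> ((nat ^ 'n) \<Rightarrow>\<^sub>0 'k)" where
  "of_poly = inv_into (carrier K_S) to_poly"

lemma to_poly_image: "to_poly ` carrier K_S = V"
  using to_poly_in_V to_poly_onto by blast

lemma to_poly_of_poly: "q \<in> V \<Longrightarrow> to_poly (of_poly q) = q"
  unfolding of_poly_def by (rule f_inv_into_f) (simp add: to_poly_image)

lemma of_poly_in_K_S: "q \<in> V \<Longrightarrow> of_poly q \<in> carrier K_S"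
  unfolding of_poly_def by (rule inv_into_into) (simp add: to_poly_image)

lemma of_poly_to_poly: "p \<in> carrier K_S \<Longrightarrow> of_poly (to_poly p) = p"
  unfolding of_poly_def by (rule inv_into_f_f[OF inj_to_poly])

lemma semigroup_ring_model: "ring_model V K_S of_poly"
proof
  show "carrier K_S = of_poly ` V"
    using of_poly_in_K_S of_poly_to_poly to_poly_in_V by force
  show "inj_on of_poly V"
    by (metis inj_onI to_poly_of_poly)
  show "\<one>\<^bsub>K_S\<^esub> = of_poly 1"
  proof -
    have "1 = Poly_Mapping.single (point (0, 0)) (1::'k)" by (simp add: point_zero)
    then have "to_poly 1 = 1" using to_poly_single[of 0 0 1] by simp
    moreover have "1 \<in> carrier K_S"
      using point_in_S_iff[of 0 0] by (simp add: carrier_K_S point_zero)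
    ultimately show ?thesis
      using of_poly_to_poly[of 1] by (simp add: semigroup_ring_def)
  qed
  show "\<zero>\<^bsub>K_S\<^esub> = of_poly 0"
    using of_poly_to_poly[of 0] by (simp add: semigroup_ring_def to_poly_def)
  fix x y assume xy: "x \<in> V" "y \<in> V"
  have mult: "p \<otimes>\<^bsub>K_S\<^esub> q = p * q" and add: "p \<oplus>\<^bsub>K_S\<^esub> q = p + q" for p q
    by (simp_all add: semigroup_ring_def)
  have "of_poly x * of_poly y \<in> carrier K_S"
    using xy by (intro K_S_mult_closed of_poly_in_K_S)
  then show "of_poly x \<otimes>\<^bsub>K_S\<^esub> of_poly y = of_poly (x * y)"
    using xy of_poly_to_poly[of "of_poly x * of_poly y"]
    by (simp add: mult to_poly_mult to_poly_of_poly of_poly_in_K_S)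
  have "of_poly x + of_poly y \<in> carrier K_S"
    using of_poly_in_K_S[OF xy(1)] of_poly_in_K_S[OF xy(2)] Poly_Mapping.keys_add[of "of_poly x" "of_poly y"]
    by (auto simp: carrier_K_S)
  then show "of_poly x \<oplus>\<^bsub>K_S\<^esub> of_poly y = of_poly (x + y)"
    using xy of_poly_to_poly[of "of_poly x + of_poly y"]
    by (simp add: add to_poly_add to_poly_of_poly of_poly_in_K_S)
qed

text \<open>An element of \<open>V\<close> without constant term is a combination of nonconstant monomials of \<open>V\<close>, and these are
the images of the generators of the ideal.\<close>

lemma monomial_maximal_ideal_eq: "(monomial_maximal_ideal S :: ((nat ^ 'n) \<Rightarrow>\<^sub>0 'k) set) = of_poly ` V_max"
proof -
  interpret R: ring_model V K_S of_poly by (rule semigroup_ring_model)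
  let ?X = "(\<lambda>(m, j). monom (monom (1::'k) j) m) ` {(m, j). j \<le> k * m \<and> (m, j) \<noteq> (0, 0)}"
  have single_eq: "Poly_Mapping.single (point (m, j)) 1 = of_poly (monom (monom 1 j) m)" if "j \<le> k * m" for m j
    using of_poly_to_poly[OF single_in_K_S, of "point (m, j)" 1] that
    by (simp add: to_poly_single point_in_S_iff)
  have "S - {0} = point ` {(m, j). j \<le> k * m \<and> (m, j) \<noteq> (0, 0)}"
    unfolding point_zero[symmetric] by (auto simp: S_def point_eq_iff)
  then have gens: "(\<lambda>s. Poly_Mapping.single s 1) ` (S - {0}) = of_poly ` ?X"
    by (simp only: image_image) (auto simp: single_eq intro!: image_cong)
  have ideal: "V.ideal_in V_max"
    by (auto simp: V.ideal_in_def V_max_def V.closed coeff_mult_0)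
  have "?X \<subseteq> V_max"
    by (auto simp: V_max_def degree_monom_eq intro!: monom_in_V gr0I)
  moreover have "V_max \<subseteq> J" if J: "V.ideal_in J" "?X \<subseteq> J" for J
  proof
    fix p assume p: "p \<in> V_max"
    have mono: "monom (monom c j) m \<in> J" if "j \<le> k * m" "m \<noteq> 0" for c j m
    proof -
      have "monom (monom c j) m = [:[:c:]:] * monom (monom 1 j) m"
        by (simp add: smult_monom)
      moreover have "[:[:c:]:] \<in> V" by (simp add: V_def coeff_pCons split: nat.split)
      moreover have "monom (monom 1 j) m \<in> J" using J(2) that by auto
      ultimately show ?thesis using J(1) unfolding V.ideal_in_def by metis
    qed
    have "monom (coeff p m) m \<in> J" for m
    proof (cases "m = 0")
      case True
      then show ?thesis using p J(1) by (simp add: V_max_def V.ideal_in_def)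
    next
      case False
      have deg: "Polynomial.degree (coeff p m) \<le> k * m" using p VD by (auto simp: V_max_def)
      have "monom (coeff p m) m = (\<Sum>j\<le>Polynomial.degree (coeff p m). monom (monom (coeff (coeff p m) j) j) m)"
        by (subst monom_sum[symmetric]) (simp only: poly_as_sum_of_monoms)
      also have "\<dots> \<in> J"
        using deg False by (intro V.ideal_in_sum[OF J(1)] mono) auto
      finally show ?thesis .
    qed
    then have "(\<Sum>m\<le>Polynomial.degree p. monom (coeff p m) m) \<in> J"
      by (intro V.ideal_in_sum[OF J(1)])
    then show "p \<in> J" by (simp only: poly_as_sum_of_monoms)
  qed
  ultimately show ?thesis
    unfolding monomial_maximal_ideal_def gens using R.genideal_image[OF ideal] by blast
qed

theorem cohen_macaulay_type:
  "has_cohen_macaulay_type (localization K_S (monomial_maximal_ideal S)) (k - 1)"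
  unfolding monomial_maximal_ideal_eq
  by (rule has_cohen_macaulay_type_model[OF localization_model[OF semigroup_ring_model]])

end

section \<open>Quasi-Frobenius elements and Cohen-Macaulay type\<close>

theorem theorem3p5:
  fixes a d :: "nat ^ 2" and k :: nat and S :: "(nat ^ 2) set"
  assumes "k \<ge> 2"
    and "lin_indep_rat a d"
    and "S = affine_semigroup (arith_gens a d k)"
    and "minimal_generating_set (arith_gens a d k) S"
  shows "quasi_frobenius S {a, a + k *s d} = (\<lambda>i. - int_vec (a + i *s d)) ` {1..k - 1}
    \<and> has_cohen_macaulay_type
        (localization (semigroup_ring S :: ((nat ^ 2) \<Rightarrow>\<^sub>0 'k::field) ring)
           (monomial_maximal_ideal S))
        (k - 1)"
proof -
  interpret arithmetic_semigroup k "TYPE('k)" a d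
    by unfold_locales (use assms in auto)
  have "S = arithmetic_semigroup.S k a d"
    using assms(3) affine_semigroup_eq by simp
  then show ?thesis
    using quasi_frobenius_eq cohen_macaulay_type by simp
qed

end
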